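(* Let $G=(V,w)$ be a weighted graph, let $o\in V$ be a vertex and $z\subset V$ a vertex set with $\mathrm{dist}(o,z)\ge n+1$ for some integer $n\ge 0$. Consider the bounds $$\mathbf E\,T_{oz}\ \ge\ m_g n+1,\qquad \mathbf P(T_{oz}\le an+1)\ \le\ e^{-I_g(a)n},\qquad ( * )$$ where $g$ may be taken to be either (a) the solution $g>1$ of $(g-1)^2g^{n-2}=2w_z/w_o$, or (b) $g=(w_zr_{oz})^{1/n}$. (i) The bounds $( * )$ still hold if $g$ (as given by (a) or by (b)) is replaced by a greater quantity. (ii) Set $\alpha:=\max\{n^2w_z/w_o,\ e\}$. Then an upper bound for the $g$ in (a) is given by $$g':=\left[\frac{5\alpha}{(\log\alpha)^2}\right]^{\frac1{n-2}}.$$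
   Context: A weighted graph $G=(V,w)$ is a set $V$ of vertices with a symmetric nonnegative function $w$ on $V\times V$; the edges of $G$ are given by the support of $w$. The weight $w_x$ of a vertex $x$ is the sum of the weights over all incident edges, and the weight $w_z$ of a vertex set $z$ is the sum of the weights of the vertices in the set. The random walk on $G$ at each step chooses a neighboring site at random with odds given by the edge weights and moves there. $T_{oz}$ is the first time the walk, started at $o$ at time $0$, visits $z$, and $\mathrm{dist}$ is graph distance. $r_{oz}$ is the effective resistance between $o$ and $z$ when $G$ is thought of as an electric network with conductances given by the edge weights. $m_g$ and $I_g(a)$ denote the mean and the large deviation rate function of the hitting time $T'_{01}$ (of $1$ from $0$) for biased simple random walk on the integers with odds $1$ and $g$ of going left and right, respectively; the classical formulas are $$m_g=\mathbf E\,T'_{01}=\frac{g+1}{g-1},\qquad e^{-I_g(a)}=\frac{g}{a+1}\Big(\frac{g}{a^2-1}\Big)^{\frac{a-1}{2}}\Big(\frac{2a}{g+1}\Big)^a.$$ $\log$ is the natural logarithm.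
   Formalization: The tail bound is proved for 1 ≤ a ≤ m_g (g the value used in the bound), since above the mean it fails for large a and below 1 the formula is undefined; (ii) is proved for n ≥ 3, since at n = 2 the exponent is undefined and at n = 0, 1 one has g' < 1 < g. *)

theory Defs
  imports "HOL-Probability.Probability"
begin

section \<open>Weighted graphs\<close>

text \<open>
  The vertex set is the type \<open>'a\<close>, of arbitrary cardinality. A graph on a subset of \<open>'a\<close> is covered
  by extending its weight function by 0. Self-loops and infinitely many neighbours are allowed, but
  the weight of each vertex has to be finite, since otherwise the random walk is not defined.
\<close>

definition weighted_graph :: "('a \<Rightarrow> 'a \<Rightarrow> real) \<Rightarrow> bool" where
  "weighted_graph w \<longleftrightarrow>
     (\<forall>x y. w x y = w y x) \<and> (\<forall>x y. 0 \<le> w x y) \<and> (\<forall>x. (\<lambda>y. w x y) summable_on UNIV)"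

definition vertex_weight :: "('a \<Rightarrow> 'a \<Rightarrow> real) \<Rightarrow> 'a \<Rightarrow> real" where
  "vertex_weight w x = (\<Sum>\<^sub>\<infinity>y\<in>UNIV. w x y)"

definition set_weight :: "('a \<Rightarrow> 'a \<Rightarrow> real) \<Rightarrow> 'a set \<Rightarrow> real" where
  "set_weight w z = (\<Sum>\<^sub>\<infinity>x\<in>z. vertex_weight w x)"

definition edges :: "('a \<Rightarrow> 'a \<Rightarrow> real) \<Rightarrow> ('a \<times> 'a) set" where
  "edges w = {(x, y). w x y \<noteq> 0}"

text \<open>The distance is \<open>\<infinity>\<close> if \<open>z\<close> cannot be reached.\<close>

definition graph_dist :: "('a \<Rightarrow> 'a \<Rightarrow> real) \<Rightarrow> 'a \<Rightarrow> 'a set \<Rightarrow> enat" where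
  "graph_dist w x z = (INF k\<in>{k. \<exists>y\<in>z. (x, y) \<in> edges w ^^ k}. enat k)"

section \<open>Effective resistance\<close>

text \<open>
  The effective conductance between \<open>x\<close> and \<open>z\<close> is the least energy dissipated by a potential that
  is 1 at \<open>x\<close> and 0 on \<open>z\<close>. The factor 1/2 is there because the sum counts every edge twice. In an
  infinite graph all potentials are admitted (free boundary conditions at infinity). The resistance
  is \<open>\<infinity>\<close> if \<open>z\<close> cannot be reached.
\<close>

definition energy :: "('a \<Rightarrow> 'a \<Rightarrow> real) \<Rightarrow> ('a \<Rightarrow> real) \<Rightarrow> ennreal" where
  "energy w v = (\<Sum>\<^sub>\<infinity>(x, y)\<in>UNIV. ennreal (w x y * (v x - v y)\<^sup>2)) / 2"

definition eff_conductance :: "('a \<Rightarrow> 'a \<Rightarrow> real) \<Rightarrow> 'a \<Rightarrow> 'a set \<Rightarrow> ennreal" where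
  "eff_conductance w x z = (INF v\<in>{v. v x = 1 \<and> (\<forall>y\<in>z. v y = 0)}. energy w v)"

definition eff_resistance :: "('a \<Rightarrow> 'a \<Rightarrow> real) \<Rightarrow> 'a \<Rightarrow> 'a set \<Rightarrow> ennreal" where
  "eff_resistance w x z = inverse (eff_conductance w x z)"

section \<open>Random walks and hitting times\<close>

text \<open>
  \<open>X\<close> is a realisation, on the probability space \<open>M\<close>, of the random walk started at \<open>x\<^sub>0\<close>. Where the
  walk starts from a vertex of positive weight it never reaches one of weight 0, so that the value
  of \<open>w (p t) y / 0\<close> is irrelevant.
\<close>

definition random_walk ::
    "('a \<Rightarrow> 'a \<Rightarrow> real) \<Rightarrow> 'a \<Rightarrow> 'b measure \<Rightarrow> (nat \<Rightarrow> 'b \<Rightarrow> 'a) \<Rightarrow> bool" where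
  "random_walk w x\<^sub>0 M X \<longleftrightarrow>
     prob_space M \<and>
     (\<forall>t. X t \<in> measurable M (count_space UNIV)) \<and>
     measure M {\<omega>\<in>space M. X 0 \<omega> = x\<^sub>0} = 1 \<and>
     (\<forall>t p y. measure M {\<omega>\<in>space M. (\<forall>i\<le>t. X i \<omega> = p i) \<and> X (Suc t) \<omega> = y} =
        measure M {\<omega>\<in>space M. \<forall>i\<le>t. X i \<omega> = p i} * (w (p t) y / vertex_weight w (p t)))"

definition hitting_time :: "(nat \<Rightarrow> 'a) \<Rightarrow> 'a set \<Rightarrow> enat" where
  "hitting_time x z = (INF k\<in>{k. x k \<in> z}. enat k)"

section \<open>Biased walk on the integers\<close>

definition biased_steps :: "real \<Rightarrow> bool stream measure" where
  "biased_steps g = stream_space (measure_pmf (bernoulli_pmf (g / (1 + g))))"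

definition biased_walk :: "bool stream \<Rightarrow> nat \<Rightarrow> int" where
  "biased_walk \<omega> t = (\<Sum>i<t. if \<omega> !! i then 1 else - 1)"

definition biased_hit :: "bool stream \<Rightarrow> enat" where
  "biased_hit \<omega> = hitting_time (biased_walk \<omega>) {1}"

definition m_hit :: "real \<Rightarrow> ennreal" where
  "m_hit g = (\<integral>\<^sup>+\<omega>. ennreal_of_enat (biased_hit \<omega>) \<partial>biased_steps g)"

text \<open>
  The rate function is the Legendre transform of the logarithmic moment generating function, taken
  over the parameters at which the latter is finite. It is used for \<open>g > 1\<close>, where the hitting time
  is almost surely finite (so the value of \<open>the_enat \<infinity>\<close> is irrelevant), and for \<open>a \<ge> 1\<close>, where the
  supremum is finite. For \<open>a > 1\<close> it satisfies
  \<open>exp (- I) = g / (a + 1) * (g / (a\<^sup>2 - 1)) powr ((a - 1) / 2) * (2 * a / (g + 1)) powr a\<close>, and at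
  \<open>a = 1\<close> it is the continuous extension, \<open>exp (- I) = g / (g + 1)\<close>.
\<close>

definition hit_exp_params :: "real \<Rightarrow> real set" where
  "hit_exp_params g =
     {l. integrable (biased_steps g) (\<lambda>\<omega>. exp (l * real (the_enat (biased_hit \<omega>))))}"

definition log_mgf :: "real \<Rightarrow> real \<Rightarrow> real" where
  "log_mgf g l = ln (\<integral>\<omega>. exp (l * real (the_enat (biased_hit \<omega>))) \<partial>biased_steps g)"

definition I_rate :: "real \<Rightarrow> real \<Rightarrow> real" where
  "I_rate g a = (SUP l\<in>hit_exp_params g. l * a - log_mgf g l)"

section \<open>The bounds\<close>

text \<open>
  For \<open>a\<close> above the mean, the second inequality is not a large deviation bound for this (lower)
  tail and fails in general; for \<open>a < 1\<close> the biased walk cannot hit 1 by time \<open>a\<close>.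
\<close>

definition hitting_bounds :: "'b measure \<Rightarrow> ('b \<Rightarrow> enat) \<Rightarrow> nat \<Rightarrow> real \<Rightarrow> bool" where
  "hitting_bounds M T n g \<longleftrightarrow>
     (\<integral>\<^sup>+\<omega>. ennreal_of_enat (T \<omega>) \<partial>M) \<ge> m_hit g * of_nat n + 1 \<and>
     (\<forall>a. 1 \<le> a \<and> ennreal a \<le> m_hit g \<longrightarrow>
        measure M {\<omega>\<in>space M. ereal_of_enat (T \<omega>) \<le> ereal (a * real n + 1)}
          \<le> exp (- I_rate g a * real n))"

definition growth_a :: "('a \<Rightarrow> 'a \<Rightarrow> real) \<Rightarrow> 'a \<Rightarrow> 'a set \<Rightarrow> nat \<Rightarrow> real \<Rightarrow> bool" where
  "growth_a w x z n g \<longleftrightarrow>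
     1 < g \<and> (g - 1)\<^sup>2 * g powi (int n - 2) = 2 * set_weight w z / vertex_weight w x"

text \<open>The formula \<open>(w\<^sub>z r)\<^sup>1\<^sup>/\<^sup>n\<close> defines a real number only if \<open>n\<close> is positive and \<open>r\<close> is finite.\<close>

definition growth_b :: "('a \<Rightarrow> 'a \<Rightarrow> real) \<Rightarrow> 'a \<Rightarrow> 'a set \<Rightarrow> nat \<Rightarrow> real \<Rightarrow> bool" where
  "growth_b w x z n g \<longleftrightarrow>
     0 < n \<and> eff_resistance w x z < \<infinity> \<and>
     g = (set_weight w z * enn2real (eff_resistance w x z)) powr (1 / real n)"

end

theory Submission
  imports Defs
begin

text \<open>
  Both bounds follow from one inequality between Laplace transforms. For \<open>0 < s < 1\<close> let \<open>\<phi>\<close> be the transform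
  \<open>E s\<^sup>T\<^sup>'\<close> of the time \<open>T'\<close> in which the biased walk with odds \<open>g > 1\<close> first hits 1. Then \<open>E s\<^sup>T \<le> s * \<phi> ^ n\<close> for the
  hitting time \<open>T\<close> of the graph, provided that either \<open>w\<^sub>z * r \<le> g ^ n\<close> or \<open>2 * w\<^sub>z / w\<^sub>o \<le> (1 - 1 / g)\<^sup>2 * g ^ n\<close>.
  Letting \<open>s\<close> tend to 1 gives the bound for the mean, and Markov's inequality the bound for the tail
  (\<open>hitting_bounds_of_laplace\<close>). The two conditions are inherited by every greater \<open>g\<close>, and so are the
  bounds.

  It suffices to consider the walk killed outside a finite set of vertices disjoint from \<open>z\<close> (\<open>laplace_le\<close>). Let \<open>u\<close> be
  its discounted hitting probability and \<open>v\<close> its discounted Green function from \<open>o\<close>, and let \<open>U = u o\<close>. The derivative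
  of \<open>ln U\<close> with respect to \<open>ln s\<close> is the mean number of steps of the walk conditioned to hit \<open>z\<close> with weights \<open>s ^ t\<close>
  (\<open>hit_src_deriv\<close>). This is a reversible walk, whose net flow from \<open>o\<close> to \<open>z\<close> is driven by the potential \<open>f = v / u\<close>.
  An edge from \<open>x\<close> to \<open>y\<close> is crossed \<open>(f x + f y) / (f x - f y)\<close> times per unit of net flow, which is \<open>coth (L / 2)\<close> if \<open>f\<close>
  decreases by the factor \<open>exp L\<close>. Since \<open>coth\<close> is convex, the cheapest way to let \<open>f\<close> decrease along the at least \<open>n\<close>
  edges before the last one is a constant factor \<open>G\<close>, as for a biased walk. If \<open>coth\<close> is replaced by its tangent at \<open>ln G\<close>,
  the sum over the edges telescopes, and only \<open>f\<close> at \<open>o\<close> and at the last vertices before \<open>z\<close> remains. The latter is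
  controlled by \<open>w\<^sub>z\<close>, the former by \<open>v o \<le> r\<close> (\<open>visits_ge_resistance\<close>, \<open>green_le_resistance\<close>). If only \<open>w\<^sub>o\<close> is known,
  a large \<open>v o\<close> has to be paid for by \<open>w\<^sub>o * v o\<close> visits to \<open>o\<close> (\<open>visits_ge_weight\<close>).

  Taking \<open>G = g / \<phi>\<^sup>2\<close>, the odds of the biased walk tilted in the same way, one finds that \<open>ln U\<close> has a greater derivative
  than \<open>ln (s * \<phi> ^ n)\<close> wherever it is greater. As \<open>U \<le> s\<close> and \<open>\<phi> \<rightarrow> 1\<close> in the limit \<open>s \<rightarrow> 1\<close>, it is nowhere greater
  (\<open>laplace_comparison\<close>).
\<close>

section \<open>Tangents to the hyperbolic cotangent\<close>

text \<open>
  With \<open>G = exp L\<close> these are the value of \<open>coth (L / 2)\<close> and the negative of its derivative in \<open>L\<close>. For \<open>G > 1\<close>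
  the value is the mean hitting time of the biased walk with odds \<open>G\<close>.
\<close>

definition coth_val :: "real \<Rightarrow> real" where
  "coth_val G = (G + 1) / (G - 1)"

definition coth_slope :: "real \<Rightarrow> real" where
  "coth_slope G = 2 * G / (G - 1)\<^sup>2"

text \<open>
  Convexity of \<open>coth\<close>. As functions of \<open>\<rho>\<close> the difference of the two sides decreases up to \<open>G\<close> and increases
  from there on, so that no second derivative is needed.
\<close>

lemma coth_tangent:
  fixes \<rho> G :: real
  assumes "1 < G" "1 < \<rho>"
  shows "coth_val G + coth_slope G * (ln G - ln \<rho>) \<le> coth_val \<rho>"
proof -
  define h where "h = (\<lambda>x::real. (x + 1) / (x - 1) + coth_slope G * ln x)"
  have der: "(h has_real_derivative (coth_slope G / x - 2 / (x - 1)\<^sup>2)) (at x)" if "1 < x" for x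
    unfolding h_def using that
    by (auto intro!: derivative_eq_intros simp: field_simps power2_eq_square)
  have sgn: "coth_slope G / x - 2 / (x - 1)\<^sup>2 =
      2 * (x - G) * (x * G - 1) / ((G - 1)\<^sup>2 * x * (x - 1)\<^sup>2)" if "1 < x" for x
  proof -
    have "G - 1 \<noteq> 0" "x - 1 \<noteq> 0" "x \<noteq> 0" using that assms by auto
    then show ?thesis
      by (simp add: coth_slope_def divide_simps) algebra
  qed
  have "h G \<le> h \<rho>"
  proof (cases "G \<le> \<rho>")
    case True
    show ?thesis
    proof (rule DERIV_nonneg_imp_nondecreasing[OF True])
      fix x assume "G \<le> x" "x \<le> \<rho>"
      then have "1 < x" "0 \<le> x - G" "0 \<le> x * G - 1"
        using assms by (auto intro: less_imp_le simp: less_1_mult)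
      then show "\<exists>y. DERIV h x :> y \<and> 0 \<le> y"
        using der[of x] assms unfolding sgn[OF \<open>1 < x\<close>] by (intro exI[of _ "2 * (x - G) * (x * G - 1) / ((G - 1)\<^sup>2 * x * (x - 1)\<^sup>2)"]) auto
    qed
  next
    case False
    then have "\<rho> \<le> G" by simp
    show ?thesis
    proof (rule DERIV_nonpos_imp_nonincreasing[OF \<open>\<rho> \<le> G\<close>])
      fix x assume "\<rho> \<le> x" "x \<le> G"
      then have x: "1 < x" "x - G \<le> 0" "0 \<le> x * G - 1"
        using assms by (auto intro: less_imp_le simp: less_1_mult)
      have "2 * (x - G) * (x * G - 1) / ((G - 1)\<^sup>2 * x * (x - 1)\<^sup>2) \<le> 0"
        using x by (intro divide_nonpos_nonneg mult_nonpos_nonneg mult_nonneg_nonpos) (auto intro: mult_nonneg_nonneg)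
      then show "\<exists>y. DERIV h x :> y \<and> y \<le> 0"
        using der[OF \<open>1 < x\<close>] unfolding sgn[OF \<open>1 < x\<close>] by blast
    qed
  qed
  then show ?thesis
    by (simp add: h_def coth_val_def algebra_simps)
qed

lemma coth_val_gt_1: "1 < G \<Longrightarrow> 1 < coth_val G"
  by (simp add: coth_val_def field_simps)

lemma coth_slope_pos: "1 < G \<Longrightarrow> 0 < coth_slope G"
  by (simp add: coth_slope_def)

text \<open>
  Along an edge crossed by a flow proportional to \<open>a - b\<close>, the time \<open>a + b\<close> spent on it is at least the drop of a
  potential: the tangent makes the nonlinear cost \<open>coth\<close> additive along paths. The inequality keeps its form when
  the two ends are exchanged, so that no orientation has to be chosen. The difference \<open>\<delta>\<close> of the levels of the two
  ends may have any sign, since the axis intercept \<open>\<kappa>\<close> of the tangent is positive.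
\<close>

lemma edge_inequality:
  fixes a b \<delta> G :: real
  assumes "1 < G" "0 < a" "0 < b" "\<bar>\<delta>\<bar> \<le> 1"
  defines "\<kappa> \<equiv> coth_val G + coth_slope G * ln G"
  shows "(a - b) * (\<kappa> * \<delta> + coth_slope G * (ln b - ln a)) \<le> a + b"
proof -
  have \<kappa>: "0 \<le> \<kappa>"
    unfolding \<kappa>_def using coth_val_gt_1[OF assms(1)] coth_slope_pos[OF assms(1)] assms(1)
    by (intro add_nonneg_nonneg mult_nonneg_nonneg) auto
  have main: "(p - q) * (\<kappa> * \<epsilon> + coth_slope G * (ln q - ln p)) \<le> p + q"
    if "0 < q" "q < p" "\<bar>\<epsilon>\<bar> \<le> 1" for p q \<epsilon> :: real
  proof -
    have "\<kappa> * \<epsilon> + coth_slope G * (ln q - ln p) \<le> \<kappa> * 1 + coth_slope G * (ln q - ln p)"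
      using \<kappa> that(3) by (intro add_right_mono mult_left_mono) auto
    also have "\<dots> = coth_val G + coth_slope G * (ln G - ln (p / q))"
      using that by (simp add: \<kappa>_def ln_div algebra_simps)
    also have "\<dots> \<le> coth_val (p / q)"
      using that assms(1) by (intro coth_tangent) auto
    also have "\<dots> = (p + q) / (p - q)"
      using that by (simp add: coth_val_def divide_simps)
    finally show ?thesis
      using that by (simp add: field_simps)
  qed
  consider "b < a" | "a < b" | "a = b" by linarith
  then show ?thesis
  proof cases
    case 1 then show ?thesis using main[of b a \<delta>] assms by simp
  next
    case 2 then show ?thesis using main[of a b "- \<delta>"] assms by (simp add: algebra_simps)
  next
    case 3 then show ?thesis using assms by simp
  qed
qed

section \<open>Killed walks on finite networks\<close>

text \<open>
  The walk steps from \<open>x\<close> to \<open>y\<close> with probability \<open>w x y / D x\<close>, exits to the target with probability \<open>b x / D x\<close>, and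
  dies otherwise. For a finite part of a graph, death is the step out of that part.
\<close>

locale killed_walk =
  fixes F :: "'a set" and src :: 'a and w :: "'a \<Rightarrow> 'a \<Rightarrow> real" and D b :: "'a \<Rightarrow> real"
  assumes finite_F: "finite F"
    and root_in: "src \<in> F"
    and w_sym: "w x y = w y x"
    and w_nonneg: "0 \<le> w x y"
    and b_nonneg: "0 \<le> b x"
    and D_pos: "x \<in> F \<Longrightarrow> 0 < D x"
    and outflow: "x \<in> F \<Longrightarrow> (\<Sum>y\<in>F. w x y) + b x \<le> D x"
begin

primrec iter :: "('a \<Rightarrow> real) \<Rightarrow> nat \<Rightarrow> 'a \<Rightarrow> real" where
  "iter f 0 = f"
| "iter f (Suc t) = (\<lambda>x. (\<Sum>y\<in>F. w x y * iter f t y) / D x)"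

text \<open>
  The powers of the transition operator are self-adjoint with respect to \<open>D\<close>, so that one resolvent gives both the
  discounted hitting probability and, when applied to the normalised point mass at the source, the density of the
  discounted visits with respect to \<open>D\<close>.
\<close>

definition resolvent :: "real \<Rightarrow> ('a \<Rightarrow> real) \<Rightarrow> 'a \<Rightarrow> real" where
  "resolvent s f x = (\<Sum>t. iter f t x * s ^ t)"

lemma iter_bounds:
  assumes "\<And>x. x \<in> F \<Longrightarrow> 0 \<le> f x \<and> f x \<le> B" "x \<in> F"
  shows "0 \<le> iter f t x \<and> iter f t x \<le> B"
  using assms(2)
proof (induction t arbitrary: x)
  case 0
  then show ?case using assms(1) by simp
next
  case (Suc t)
  have B: "0 \<le> B" using assms(1)[OF Suc.prems] by linarith
  have "(\<Sum>y\<in>F. w x y * iter f t y) \<le> (\<Sum>y\<in>F. w x y * B)"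
    using Suc.IH w_nonneg by (intro sum_mono mult_left_mono) auto
  also have "\<dots> \<le> D x * B"
    using outflow[OF Suc.prems] b_nonneg[of x] B
    by (simp flip: sum_distrib_right) (intro mult_right_mono, auto)
  finally show ?case
    using D_pos[OF Suc.prems] Suc.IH w_nonneg
    by (auto simp: divide_le_eq mult.commute intro!: divide_nonneg_nonneg sum_nonneg)
qed

lemma iter_summable:
  assumes "\<And>x. x \<in> F \<Longrightarrow> 0 \<le> f x" "x \<in> F" "0 \<le> s" "s < (1::real)"
  shows "summable (\<lambda>t. iter f t x * s ^ t)"
proof -
  define B where "B = Max (f ` F)"
  have "0 \<le> iter f t x \<and> iter f t x \<le> B" for t
    using assms(1,2) finite_F by (intro iter_bounds) (auto simp: B_def)
  then show ?thesis
    using assms(3,4)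
    by (intro summable_comparison_test'[OF summable_mult[OF summable_geometric, of s B]])
       (auto simp: abs_mult intro: mult_right_mono)
qed

lemma resolvent_nonneg:
  assumes "\<And>x. x \<in> F \<Longrightarrow> 0 \<le> f x" "x \<in> F" "0 \<le> s" "s < 1"
  shows "0 \<le> resolvent s f x"
proof -
  have "0 \<le> iter f t x" for t
    using iter_bounds[of f "Max (f ` F)" x t] assms(1,2) finite_F by auto
  then show ?thesis
    unfolding resolvent_def using assms
    by (intro suminf_nonneg iter_summable) auto
qed

lemma resolvent_eq:
  assumes "\<And>x. x \<in> F \<Longrightarrow> 0 \<le> f x" "x \<in> F" "0 \<le> s" "s < 1"
  shows "D x * resolvent s f x = D x * f x + s * (\<Sum>y\<in>F. w x y * resolvent s f y)"
proof -
  note [simp] = iter_summable[OF assms(1) _ assms(3,4)]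
  have "resolvent s f x = f x + (\<Sum>t. iter f (Suc t) x * s ^ Suc t)"
    unfolding resolvent_def using assms(2) by (subst suminf_split_head) auto
  also have "(\<lambda>t. iter f (Suc t) x * s ^ Suc t) =
      (\<lambda>t. s / D x * (\<Sum>y\<in>F. w x y * (iter f t y * s ^ t)))"
    by (simp add: sum_distrib_left sum_divide_distrib sum_distrib_right algebra_simps)
  also have "(\<Sum>t. s / D x * (\<Sum>y\<in>F. w x y * (iter f t y * s ^ t))) =
      s / D x * (\<Sum>t. \<Sum>y\<in>F. w x y * (iter f t y * s ^ t))"
    by (intro suminf_mult summable_sum summable_mult) auto
  also have "(\<Sum>t. \<Sum>y\<in>F. w x y * (iter f t y * s ^ t)) = (\<Sum>y\<in>F. w x y * resolvent s f y)"
    by (simp add: resolvent_def suminf_mult summable_mult suminf_sum)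
  finally show ?thesis
    using D_pos[OF assms(2)] by (simp add: field_simps)
qed

lemma isCont_resolvent:
  assumes "\<And>x. x \<in> F \<Longrightarrow> 0 \<le> f x" "x \<in> F" "0 \<le> s" "s < 1"
  shows "isCont (\<lambda>s. resolvent s f x) s"
proof -
  obtain r where "s < r" "r < 1" using dense[OF assms(4)] by blast
  then show ?thesis
    unfolding resolvent_def using assms
    by (intro isCont_powser[of _ r] iter_summable) auto
qed

definition hit :: "real \<Rightarrow> 'a \<Rightarrow> real" where
  "hit s x = s * resolvent s (\<lambda>x. b x / D x) x"

definition green :: "real \<Rightarrow> 'a \<Rightarrow> real" where
  "green s = resolvent s (\<lambda>x. if x = src then 1 / D src else 0)"

lemma hit_nonneg: "x \<in> F \<Longrightarrow> 0 \<le> s \<Longrightarrow> s < 1 \<Longrightarrow> 0 \<le> hit s x"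
  unfolding hit_def using D_pos b_nonneg
  by (intro mult_nonneg_nonneg resolvent_nonneg) (auto intro!: divide_nonneg_pos)

lemma green_nonneg: "x \<in> F \<Longrightarrow> 0 \<le> s \<Longrightarrow> s < 1 \<Longrightarrow> 0 \<le> green s x"
  unfolding green_def using D_pos root_in
  by (intro resolvent_nonneg) (auto intro!: divide_nonneg_pos less_imp_le)

lemma hit_eq:
  assumes "x \<in> F" "0 \<le> s" "s < 1"
  shows "D x * hit s x = s * (b x + (\<Sum>y\<in>F. w x y * hit s y))"
proof -
  have "D x * resolvent s (\<lambda>x. b x / D x) x = D x * (b x / D x) +
      s * (\<Sum>y\<in>F. w x y * resolvent s (\<lambda>x. b x / D x) y)"
    using D_pos b_nonneg assms by (intro resolvent_eq) (auto intro!: divide_nonneg_pos)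
  then show ?thesis
    using D_pos[OF assms(1)]
    by (simp add: hit_def sum_distrib_left algebra_simps)
qed

lemma green_eq:
  assumes "x \<in> F" "0 \<le> s" "s < 1"
  shows "D x * green s x = (if x = src then 1 else 0) + s * (\<Sum>y\<in>F. w x y * green s y)"
proof -
  have "D x * green s x = D x * (if x = src then 1 / D src else 0) +
      s * (\<Sum>y\<in>F. w x y * green s y)"
    unfolding green_def using D_pos root_in assms
    by (intro resolvent_eq) (auto intro!: divide_nonneg_pos less_imp_le)
  then show ?thesis
    using D_pos[OF assms(1)] by auto
qed

lemma isCont_hit:
  assumes "x \<in> F" "0 \<le> s" "s < 1"
  shows "isCont (\<lambda>s. hit s x) s"
  unfolding hit_def using D_pos b_nonneg assms
  by (intro continuous_intros isCont_resolvent) (auto intro!: divide_nonneg_pos)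

text \<open>
  The maximum principle: a maximum above 1 would be smaller than itself by the factor \<open>s\<close>. The bound by \<open>s\<close> rather
  than 1 says that exiting takes at least one step.
\<close>

lemma hit_le:
  assumes "x \<in> F" "0 \<le> s" "s < 1"
  shows "hit s x \<le> s"
proof -
  define m where "m = Max (hit s ` F)"
  have le: "hit s y \<le> m" if "y \<in> F" for y
    unfolding m_def using finite_F that by auto
  have "m \<in> hit s ` F"
    unfolding m_def using finite_F root_in by (intro Max_in) auto
  then obtain y where y: "y \<in> F" "hit s y = m" by auto
  define k where "k = max 1 m"
  have "D y * m = s * (b y + (\<Sum>x\<in>F. w y x * hit s x))"
    using hit_eq[OF y(1) assms(2,3)] y(2) by simp
  also have "\<dots> \<le> s * (b y * k + (\<Sum>x\<in>F. w y x * k))"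
    using assms(2) le b_nonneg w_nonneg
    by (intro mult_left_mono add_mono sum_mono)
       (auto simp: k_def le_max_iff_disj intro: mult_left_mono[of 1 "max 1 m", simplified])
  also have "\<dots> = s * k * ((\<Sum>x\<in>F. w y x) + b y)"
    by (simp add: sum_distrib_left algebra_simps)
  also have "\<dots> \<le> s * k * D y"
    using outflow[OF y(1)] assms(2) by (intro mult_left_mono) (auto simp: k_def)
  finally have mk: "m \<le> s * k"
    using D_pos[OF y(1)] by (simp add: mult.commute)
  have "m \<le> 1"
  proof (rule ccontr)
    assume "\<not> m \<le> 1"
    then have "m \<le> s * m" "0 < m" using mk by (auto simp: k_def)
    then show False using assms(3) by simp
  qed
  then show ?thesis using mk le[OF assms(1)] by (simp add: k_def)
qed

end

section \<open>The steps of the tilted walk\<close>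

text \<open>
  Summation by parts for the net flow \<open>j x y - j y x\<close>.
\<close>

lemma antisymmetric_sum:
  fixes j :: "'a \<Rightarrow> 'a \<Rightarrow> real" and \<psi> :: "'a \<Rightarrow> real"
  assumes "finite H"
    and "\<And>x y. x \<in> H \<Longrightarrow> y \<in> H \<Longrightarrow> (j x y - j y x) * (\<psi> y - \<psi> x) \<le> j x y + j y x"
  shows "(\<Sum>y\<in>H. \<psi> y * (\<Sum>x\<in>H. j x y - j y x)) \<le> (\<Sum>x\<in>H. \<Sum>y\<in>H. j x y)"
proof -
  have swap: "(\<Sum>x\<in>H. \<Sum>y\<in>H. g y x) = (\<Sum>x\<in>H. \<Sum>y\<in>H. g x y)" for g :: "'a \<Rightarrow> 'a \<Rightarrow> real"
    by (rule sum.swap)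
  have "(\<Sum>x\<in>H. \<Sum>y\<in>H. (j x y - j y x) * (\<psi> y - \<psi> x)) \<le> (\<Sum>x\<in>H. \<Sum>y\<in>H. j x y + j y x)"
    by (intro sum_mono assms)
  also have "\<dots> = 2 * (\<Sum>x\<in>H. \<Sum>y\<in>H. j x y)"
    using swap[of j] by (simp add: sum.distrib)
  also have "(\<Sum>x\<in>H. \<Sum>y\<in>H. (j x y - j y x) * (\<psi> y - \<psi> x)) =
      (\<Sum>x\<in>H. \<Sum>y\<in>H. (j x y - j y x) * \<psi> y) + (\<Sum>x\<in>H. \<Sum>y\<in>H. (j y x - j x y) * \<psi> x)"
    by (simp add: sum.distrib[symmetric] algebra_simps)
  also have "(\<Sum>x\<in>H. \<Sum>y\<in>H. (j y x - j x y) * \<psi> x) = (\<Sum>x\<in>H. \<Sum>y\<in>H. (j x y - j y x) * \<psi> y)"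
    using swap[of "\<lambda>x y. (j x y - j y x) * \<psi> y"] by simp
  also have "(\<Sum>x\<in>H. \<Sum>y\<in>H. (j x y - j y x) * \<psi> y) = (\<Sum>y\<in>H. \<psi> y * (\<Sum>x\<in>H. j x y - j y x))"
    by (subst sum.swap) (simp add: sum_distrib_left mult.commute)
  finally show ?thesis by simp
qed

context killed_walk
begin

text \<open>
  Conditioning the walk to exit, where an exit at time \<open>t\<close> counts with the factor \<open>s ^ t\<close>, yields another
  reversible walk, with conductances \<open>w x y * hit s x * hit s y\<close>. Up to the factor \<open>hit s src\<close>, this sum is the mean
  number of its steps.
\<close>

definition visits :: "real \<Rightarrow> real" where
  "visits s = (\<Sum>x\<in>F. D x * green s x * hit s x)"

text \<open>
  The two equations are tested against each other, with different discounts. For equal discounts this expresses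
  \<open>hit\<close> at the source by \<open>green\<close>; the difference quotient in the discount gives the derivative.
\<close>

lemma reciprocity:
  assumes "0 \<le> s" "s < 1" "0 \<le> t" "t < 1"
  shows "t * hit t src = t * s * (\<Sum>x\<in>F. green s x * b x) + (t - s) * (\<Sum>x\<in>F. D x * green s x * hit t x)"
proof -
  have sw: "(\<Sum>x\<in>F. hit t x * (\<Sum>y\<in>F. w x y * green s y)) = (\<Sum>x\<in>F. green s x * (\<Sum>y\<in>F. w x y * hit t y))"
    unfolding sum_distrib_left by (subst sum.swap) (simp add: w_sym mult_ac)
  let ?Q = "\<Sum>x\<in>F. green s x * (\<Sum>y\<in>F. w x y * hit t y)"
  have 1: "(\<Sum>x\<in>F. D x * green s x * hit t x) = t * (\<Sum>x\<in>F. green s x * b x) + t * ?Q"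
  proof -
    have "(\<Sum>x\<in>F. D x * green s x * hit t x) = (\<Sum>x\<in>F. green s x * (D x * hit t x))"
      by (simp add: mult_ac)
    also have "\<dots> = (\<Sum>x\<in>F. green s x * (t * (b x + (\<Sum>y\<in>F. w x y * hit t y))))"
      using assms by (simp add: hit_eq)
    finally show ?thesis
      by (simp add: sum.distrib sum_distrib_left algebra_simps)
  qed
  have 2: "(\<Sum>x\<in>F. D x * green s x * hit t x) = hit t src + s * ?Q"
  proof -
    have "(\<Sum>x\<in>F. D x * green s x * hit t x) = (\<Sum>x\<in>F. hit t x * (D x * green s x))"
      by (simp add: mult_ac)
    also have "\<dots> = (\<Sum>x\<in>F. hit t x * ((if x = src then 1 else 0) + s * (\<Sum>y\<in>F. w x y * green s y)))"
      using assms by (simp add: green_eq)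
    also have "\<dots> = (\<Sum>x\<in>F. hit t x * (if x = src then 1 else 0)) +
        s * (\<Sum>x\<in>F. hit t x * (\<Sum>y\<in>F. w x y * green s y))"
      by (simp add: sum.distrib sum_distrib_left algebra_simps)
    also have "(\<Sum>x\<in>F. hit t x * (if x = src then 1 else 0)) = hit t src"
      using finite_F root_in by (simp add: if_distrib sum.delta cong: if_cong)
    finally show ?thesis using sw by simp
  qed
  show ?thesis using 1 2 by algebra
qed

lemma hit_src_eq:
  assumes "0 < s" "s < 1"
  shows "hit s src = s * (\<Sum>x\<in>F. green s x * b x)"
  using reciprocity[of s s] assms by simp

text \<open>
  The logarithmic derivative of a Laplace transform, here with respect to \<open>ln s\<close>, is the mean of the tilted
  distribution.
\<close>

lemma hit_src_deriv:
  assumes "0 < s" "s < 1"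
  shows "((\<lambda>s. hit s src) has_real_derivative visits s / s) (at s)"
proof -
  let ?q = "\<lambda>t. (\<Sum>x\<in>F. D x * green s x * hit t x) / t"
  have quot: "(hit t src - hit s src) / (t - s) = ?q t" if "t \<in> {0<..<1} - {s}" for t
  proof -
    have "t * hit t src = t * hit s src + (t - s) * (\<Sum>x\<in>F. D x * green s x * hit t x)"
      using reciprocity[of s t] hit_src_eq[OF assms] assms that by simp
    then show ?thesis
      using that by (simp add: field_simps)
  qed
  have "isCont ?q s"
    using assms by (intro continuous_intros isCont_hit) auto
  then have "(?q \<longlongrightarrow> visits s / s) (at s)"
    by (simp add: isCont_def visits_def)
  moreover have "eventually (\<lambda>t. ?q t = (hit t src - hit s src) / (t - s)) (at s)"
    unfolding eventually_at_topological using quot assms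
    by (intro exI[of _ "{0<..<1}"]) auto
  ultimately show ?thesis
    unfolding has_field_derivative_iff by (blast intro: Lim_transform_eventually)
qed

text \<open>
  Up to the factor \<open>hit s src\<close>, this is the mean number of steps from \<open>x\<close> to \<open>y\<close> of the conditioned walk. Its
  antisymmetric part is a flow of strength \<open>hit s src\<close> from the source to the target, driven by the potential
  \<open>green s x / hit s x\<close>.
\<close>

definition flow :: "real \<Rightarrow> 'a \<Rightarrow> 'a \<Rightarrow> real" where
  "flow s x y = s * w x y * green s x * hit s y"

lemma flow_nonneg: "x \<in> F \<Longrightarrow> y \<in> F \<Longrightarrow> 0 \<le> s \<Longrightarrow> s < 1 \<Longrightarrow> 0 \<le> flow s x y"
  unfolding flow_def by (intro mult_nonneg_nonneg w_nonneg green_nonneg hit_nonneg)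

lemma flow_out:
  assumes "x \<in> F" "0 \<le> s" "s < 1"
  shows "(\<Sum>y\<in>F. flow s x y) = D x * green s x * hit s x - s * b x * green s x"
proof -
  have "(\<Sum>y\<in>F. flow s x y) = green s x * (s * (b x + (\<Sum>y\<in>F. w x y * hit s y))) - s * b x * green s x"
    by (simp add: flow_def sum_distrib_left algebra_simps)
  then show ?thesis
    unfolding hit_eq[OF assms, symmetric] by (simp add: mult_ac)
qed

lemma flow_in:
  assumes "y \<in> F" "0 \<le> s" "s < 1"
  shows "(\<Sum>x\<in>F. flow s x y) = D y * green s y * hit s y - (if y = src then hit s src else 0)"
proof -
  have "(\<Sum>x\<in>F. flow s x y) = hit s y * (s * (\<Sum>x\<in>F. w y x * green s x))"
    by (simp add: flow_def sum_distrib_left w_sym mult_ac)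
  also have "s * (\<Sum>x\<in>F. w y x * green s x) = D y * green s y - (if y = src then 1 else 0)"
    using green_eq[OF assms] by simp
  finally show ?thesis by (simp add: right_diff_distrib mult_ac)
qed

lemma visits_eq:
  assumes "0 < s" "s < 1"
  shows "visits s = hit s src + (\<Sum>x\<in>F. \<Sum>y\<in>F. flow s x y)"
proof -
  have "(\<Sum>x\<in>F. \<Sum>y\<in>F. flow s x y) = visits s - s * (\<Sum>x\<in>F. green s x * b x)"
    using assms by (simp add: flow_out visits_def sum_subtractf sum_distrib_left mult_ac)
  then show ?thesis using hit_src_eq[OF assms] by simp
qed

lemma hit_pos_step:
  assumes "x \<in> F" "y \<in> F" "0 < w x y" "0 < hit s y" "0 < s" "s < 1"
  shows "0 < hit s x"
proof -
  have "0 < w x y * hit s y" using assms by simp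
  also have "\<dots> \<le> (\<Sum>y\<in>F. w x y * hit s y)"
    using assms finite_F by (intro member_le_sum) (auto intro!: mult_nonneg_nonneg w_nonneg hit_nonneg)
  finally have "0 < D x * hit s x"
    using hit_eq[of x s] b_nonneg[of x] assms by (simp add: add_nonneg_pos)
  then show ?thesis using D_pos[OF assms(1)] by (simp add: zero_less_mult_iff)
qed

lemma green_pos_step:
  assumes "x \<in> F" "y \<in> F" "0 < w x y" "0 < green s x" "0 < s" "s < 1"
  shows "0 < green s y"
proof -
  have "0 < w y x * green s x" using assms w_sym[of x y] by simp
  also have "\<dots> \<le> (\<Sum>x\<in>F. w y x * green s x)"
    using assms finite_F by (intro member_le_sum) (auto intro!: mult_nonneg_nonneg w_nonneg green_nonneg)
  finally have "0 < D y * green s y"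
    using green_eq[of y s] assms by (simp add: add_nonneg_pos)
  then show ?thesis using D_pos[OF assms(2)] by (simp add: zero_less_mult_iff)
qed

lemma green_root:
  assumes "0 < s" "s < 1"
  shows "1 \<le> D src * green s src"
  using green_eq[OF root_in, of s] assms
  by (simp add: sum_nonneg mult_nonneg_nonneg w_nonneg green_nonneg)

lemma green_root_pos: "0 < s \<Longrightarrow> s < 1 \<Longrightarrow> 0 < green s src"
  using green_root[of s] D_pos[OF root_in] by (smt (verit) zero_less_mult_iff)

text \<open>
  Jensen's inequality for the logarithm, under the distribution of the exit point of the flow. It is proved by the
  tangent at the constant \<open>m\<close>, which bounds the mean of \<open>hit s y / green s y\<close>.
\<close>

lemma exit_flow_ln:
  assumes "0 < s" "s < 1" "0 < hit s src" "0 < W" "(\<Sum>x\<in>F. b x) \<le> W"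
  shows "- hit s src * ln (s\<^sup>2 * W / hit s src) \<le>
    (\<Sum>y\<in>F. s * b y * green s y * ln (green s y / hit s y))"
proof -
  define m where "m = s\<^sup>2 * W / hit s src"
  have m: "0 < m" using assms by (simp add: m_def)
  have term_le: "s * b y * green s y * (- ln m + 1) - s * b y * hit s y / m \<le>
      s * b y * green s y * ln (green s y / hit s y)" if y: "y \<in> F" for y
  proof (cases "0 < b y \<and> 0 < green s y")
    case True
    have "0 < s * (b y + (\<Sum>x\<in>F. w y x * hit s x))"
      using True assms y by (intro mult_pos_pos add_pos_nonneg sum_nonneg mult_nonneg_nonneg w_nonneg hit_nonneg) auto
    then have "0 < D y * hit s y"
      using hit_eq[OF y, of s] assms by simp
    then have h: "0 < hit s y" using D_pos[OF y] by (simp add: zero_less_mult_iff)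
    have "ln (hit s y / (green s y * m)) \<le> hit s y / (green s y * m) - 1"
      using True h m by (intro ln_le_minus_one) simp
    then have "- ln m + 1 - hit s y / (green s y * m) \<le> ln (green s y / hit s y)"
      using True h m by (simp add: ln_div ln_mult)
    then have "s * b y * green s y * (- ln m + 1 - hit s y / (green s y * m)) \<le>
        s * b y * green s y * ln (green s y / hit s y)"
      using True assms by (intro mult_left_mono) auto
    moreover have "s * b y * green s y * (hit s y / (green s y * m)) = s * b y * hit s y / m"
      using True by simp
    ultimately show ?thesis by (simp only: right_diff_distrib)
  next
    case False
    then have "b y = 0 \<or> green s y = 0"
      using b_nonneg[of y] green_nonneg[OF y, of s] assms by force
    moreover have "0 \<le> s * b y * hit s y / m"
      using assms y m by (intro divide_nonneg_pos mult_nonneg_nonneg b_nonneg hit_nonneg) auto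
    ultimately show ?thesis by auto
  qed
  have "(\<Sum>y\<in>F. s * b y * hit s y / m) \<le> (\<Sum>y\<in>F. s * b y * s / m)"
    using assms m hit_le b_nonneg by (intro sum_mono divide_right_mono mult_left_mono) auto
  also have "\<dots> = s\<^sup>2 * (\<Sum>y\<in>F. b y) / m"
    by (simp add: sum_distrib_left sum_divide_distrib power2_eq_square mult_ac)
  also have "\<dots> \<le> s\<^sup>2 * W / m"
    using assms m by (intro divide_right_mono mult_left_mono) auto
  also have "\<dots> = hit s src"
    using assms by (simp add: m_def)
  finally have 1: "(\<Sum>y\<in>F. s * b y * hit s y / m) \<le> hit s src" .
  have "hit s src * (- ln m + 1) = (\<Sum>y\<in>F. s * b y * green s y * (- ln m + 1))"
    unfolding hit_src_eq[OF assms(1,2)] by (simp add: sum_distrib_left sum_distrib_right mult_ac)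
  then have "hit s src * (- ln m + 1) - (\<Sum>y\<in>F. s * b y * hit s y / m) \<le>
      (\<Sum>y\<in>F. s * b y * green s y * ln (green s y / hit s y))"
    unfolding sum_subtractf[symmetric] using term_le by (simp add: sum_mono sum_subtractf[symmetric])
  then show ?thesis
    using 1 by (simp add: m_def algebra_simps)
qed

text \<open>
  The potential \<open>\<psi>\<close> collects the level with the slope of the tangent's axis intercept, and the logarithm of the
  potential that drives the flow.
\<close>

lemma flow_edge:
  fixes d :: "'a \<Rightarrow> nat"
  assumes "0 < s" "s < 1" "x \<in> F" "y \<in> F" "1 < G"
    and "0 < w x y \<Longrightarrow> \<bar>real (d x) - real (d y)\<bar> \<le> 1"
  defines "\<psi> \<equiv> \<lambda>x. (coth_val G + coth_slope G * ln G) * real (d x) + coth_slope G * ln (green s x / hit s x)"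
  shows "(flow s x y - flow s y x) * (\<psi> y - \<psi> x) \<le> flow s x y + flow s y x"
proof (cases "0 < w x y \<and> 0 < green s x \<and> 0 < hit s x \<and> 0 < green s y \<and> 0 < hit s y")
  case True
  define a where "a z = green s z / hit s z" for z
  have f: "flow s x y = s * w x y * hit s x * hit s y * a x"
    "flow s y x = s * w x y * hit s x * hit s y * a y"
    using True by (simp_all add: flow_def a_def w_sym[of x y])
  have "\<bar>real (d y) - real (d x)\<bar> \<le> 1" using assms(6) True by simp
  then have "(a x - a y) * ((coth_val G + coth_slope G * ln G) * (real (d y) - real (d x)) +
      coth_slope G * (ln (a y) - ln (a x))) \<le> a x + a y"
    using True assms by (intro edge_inequality) (auto simp: a_def)
  then have "s * w x y * hit s x * hit s y * ((a x - a y) * (\<psi> y - \<psi> x)) \<le>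
      s * w x y * hit s x * hit s y * (a x + a y)"
    using True assms(1) by (intro mult_left_mono) (auto simp: \<psi>_def a_def algebra_simps)
  then show ?thesis
    unfolding f by (simp add: algebra_simps)
next
  case False
  have "flow s x y = 0"
  proof (rule ccontr)
    assume "flow s x y \<noteq> 0"
    then have "0 < w x y" "0 < green s x" "0 < hit s y"
      using w_nonneg[of x y] green_nonneg[of x s] hit_nonneg[of y s] assms(1-4)
      by (auto simp: flow_def intro: le_neq_trans)
    then show False
      using False hit_pos_step[of x y s] green_pos_step[of x y s] assms(1-4) by auto
  qed
  moreover have "flow s y x = 0"
  proof (rule ccontr)
    assume "flow s y x \<noteq> 0"
    then have "0 < w y x" "0 < green s y" "0 < hit s x"
      using w_nonneg[of y x] green_nonneg[of y s] hit_nonneg[of x s] assms(1-4)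
      by (auto simp: flow_def intro: le_neq_trans)
    then show False
      using False hit_pos_step[of y x s] green_pos_step[of y x s] w_sym[of x y] assms(1-4) by auto
  qed
  ultimately show ?thesis by simp
qed

lemma exit_flow_potential:
  fixes d :: "'a \<Rightarrow> nat"
  assumes "0 < s" "s < 1" "0 < hit s src" "0 < W" "(\<Sum>x\<in>F. b x) \<le> W" "0 \<le> c"
    and d: "\<And>x. x \<in> F \<Longrightarrow> 0 < b x \<Longrightarrow> d x = n"
  shows "hit s src * (\<kappa> * real n - c * ln (s\<^sup>2 * W / hit s src)) \<le>
    (\<Sum>y\<in>F. (\<kappa> * real (d y) + c * ln (green s y / hit s y)) * (s * b y * green s y))"
proof -
  have "(\<Sum>y\<in>F. (\<kappa> * real (d y) + c * ln (green s y / hit s y)) * (s * b y * green s y)) =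
      (\<Sum>y\<in>F. \<kappa> * real (d y) * (s * b y * green s y)) +
      c * (\<Sum>y\<in>F. s * b y * green s y * ln (green s y / hit s y))"
    by (simp add: sum.distrib sum_distrib_left algebra_simps)
  moreover have "(\<Sum>y\<in>F. \<kappa> * real (d y) * (s * b y * green s y)) =
      (\<Sum>y\<in>F. \<kappa> * real n * (s * b y * green s y))"
  proof (intro sum.cong refl)
    fix y assume "y \<in> F"
    then show "\<kappa> * real (d y) * (s * b y * green s y) = \<kappa> * real n * (s * b y * green s y)"
      using d[of y] b_nonneg[of y] by (cases "b y = 0") auto
  qed
  moreover have "\<dots> = \<kappa> * real n * hit s src"
    unfolding hit_src_eq[OF assms(1,2)] by (simp add: sum_distrib_left mult_ac)
  moreover have "c * (- hit s src * ln (s\<^sup>2 * W / hit s src)) \<le>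
      c * (\<Sum>y\<in>F. s * b y * green s y * ln (green s y / hit s y))"
    by (intro mult_left_mono exit_flow_ln assms)
  ultimately show ?thesis by (simp add: algebra_simps)
qed

text \<open>
  All inner vertices cancel in the summation by parts. What remains is the number \<open>n\<close> of levels, the logarithm of
  the driving potential at the source, and its mean at the exits.
\<close>

lemma visits_ge_resistance:
  fixes d :: "'a \<Rightarrow> nat"
  assumes "0 < s" "s < 1" "0 < hit s src" "0 < W" "(\<Sum>x\<in>F. b x) \<le> W" "1 < G"
    and d_root: "d src = 0"
    and d_edge: "\<And>x y. x \<in> F \<Longrightarrow> y \<in> F \<Longrightarrow> 0 < w x y \<Longrightarrow> \<bar>real (d x) - real (d y)\<bar> \<le> 1"
    and d_exit: "\<And>x. x \<in> F \<Longrightarrow> 0 < b x \<Longrightarrow> d x = n"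
  shows "hit s src * (1 + real n * (coth_val G + coth_slope G * ln G) -
      coth_slope G * ln (s\<^sup>2 * W * green s src / (hit s src)\<^sup>2)) \<le> visits s"
proof -
  define \<kappa> where "\<kappa> = coth_val G + coth_slope G * ln G"
  define c where "c = coth_slope G"
  define \<psi> where "\<psi> x = \<kappa> * real (d x) + c * ln (green s x / hit s x)" for x
  have c: "0 \<le> c" unfolding c_def using coth_slope_pos[OF assms(6)] by simp
  have "(\<Sum>y\<in>F. \<psi> y * (\<Sum>x\<in>F. flow s x y - flow s y x)) \<le> (\<Sum>x\<in>F. \<Sum>y\<in>F. flow s x y)"
    unfolding \<psi>_def \<kappa>_def c_def
    using flow_edge[OF assms(1,2) _ _ assms(6)] d_edge by (intro antisymmetric_sum finite_F) auto
  also have "(\<Sum>y\<in>F. \<psi> y * (\<Sum>x\<in>F. flow s x y - flow s y x)) =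
      (\<Sum>y\<in>F. \<psi> y * (s * b y * green s y)) - (\<Sum>y\<in>F. \<psi> y * (if y = src then hit s src else 0))"
    using assms(1,2)
    unfolding sum_subtractf[symmetric]
    by (intro sum.cong) (auto simp: sum_subtractf flow_in flow_out algebra_simps)
  also have "(\<Sum>y\<in>F. \<psi> y * (if y = src then hit s src else 0)) = \<psi> src * hit s src"
    using finite_F root_in by (simp add: if_distrib cong: if_cong)
  finally have "(\<Sum>y\<in>F. \<psi> y * (s * b y * green s y)) - \<psi> src * hit s src \<le> visits s - hit s src"
    using visits_eq[OF assms(1,2)] by simp
  then have "hit s src * (\<kappa> * real n - c * ln (s\<^sup>2 * W / hit s src)) - \<psi> src * hit s src \<le> visits s - hit s src"
    using exit_flow_potential[where d = d and n = n and \<kappa> = \<kappa>, OF assms(1-5) c d_exit] unfolding \<psi>_def by linarith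
  moreover have "ln (s\<^sup>2 * W * green s src / (hit s src)\<^sup>2) =
      ln (s\<^sup>2 * W / hit s src) + ln (green s src / hit s src)"
    using assms(1,3,4) green_root_pos[OF assms(1,2)]
    by (simp add: ln_mult ln_div power2_eq_square)
  ultimately show ?thesis
    using d_root unfolding \<psi>_def \<kappa>_def[symmetric] unfolding c_def[symmetric] by (simp add: algebra_simps)
qed

end

text \<open>
  The tangent of \<open>(r - f) * ln (f / \<mu>)\<close> at \<open>f = \<mu>\<close> is an upper bound for all \<open>f\<close>, even beyond \<open>r\<close>, where the left-hand
  side is negative. So the driving potential next to the source is not required to stay below its value at the
  source.
\<close>

lemma entrance_inequality:
  fixes f \<mu> r :: real
  assumes "0 < f" "0 < \<mu>" "\<mu> \<le> r"
  shows "(r - f) * (ln f - ln \<mu>) \<le> (r - \<mu>) / \<mu> * (f - \<mu>)"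
proof (cases "f \<le> r")
  case True
  have "ln f - ln \<mu> \<le> f / \<mu> - 1"
    using ln_le_minus_one[of "f / \<mu>"] assms by (simp add: ln_div)
  then have "(r - f) * (ln f - ln \<mu>) \<le> (r - f) * (f / \<mu> - 1)"
    using True by (intro mult_left_mono) auto
  also have "\<dots> = (r - \<mu>) / \<mu> * (f - \<mu>) - (f - \<mu>)\<^sup>2 / \<mu>"
    using assms by (simp add: field_simps power2_eq_square)
  also have "\<dots> \<le> (r - \<mu>) / \<mu> * (f - \<mu>)" using assms by simp
  finally show ?thesis .
next
  case False
  then have "(r - f) * (ln f - ln \<mu>) \<le> 0"
    using assms by (intro mult_nonpos_nonneg) auto
  also have "0 \<le> (r - \<mu>) / \<mu> * (f - \<mu>)" using False assms by auto
  finally show ?thesis .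
qed

context killed_walk
begin

text \<open>
  Without a bound on the potential at the source, the edges at the source are treated separately. Their cost is the
  mean number \<open>R\<close> of visits to the source. The remaining edges span \<open>n - 1\<close> levels, and the geometric mean of the driving
  potential at their beginning is at most \<open>\<mu>\<close>, its mean over the neighbours of the source.
\<close>

lemma visits_ge_weight:
  fixes d :: "'a \<Rightarrow> nat"
  assumes "0 < s" "s < 1" "0 < hit s src" "0 < W" "(\<Sum>x\<in>F. b x) \<le> W" "1 < G"
    and d_root: "d src = 0"
    and d_edge: "\<And>x y. x \<in> F \<Longrightarrow> y \<in> F \<Longrightarrow> 0 < w x y \<Longrightarrow> \<bar>real (d x) - real (d y)\<bar> \<le> 1"
    and d_exit: "\<And>x. x \<in> F \<Longrightarrow> 0 < b x \<Longrightarrow> d x = n"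
    and b_root: "b src = 0"
    and d_root_edge: "\<And>y. y \<in> F \<Longrightarrow> y \<noteq> src \<Longrightarrow> 0 < w src y \<Longrightarrow> d y = 1"
  defines "R \<equiv> D src * green s src"
  shows "1 < R"
    and "hit s src * (1 + R + (real n - 1) * (coth_val G + coth_slope G * ln G) -
      coth_slope G * ln (s\<^sup>2 * W * (R - 1) / (D src * (hit s src)\<^sup>2))) \<le> visits s"
proof -
  note D0 = D_pos[OF root_in]
  define U where "U = hit s src"
  have U: "0 < U" using assms by (simp add: U_def)
  have out: "(\<Sum>y\<in>F. flow s src y) = R * U"
    using flow_out[OF root_in, of s] assms by (simp add: U_def R_def)
  have inn: "(\<Sum>y\<in>F. flow s y src) = (R - 1) * U"
    using flow_in[OF root_in, of s] assms by (simp add: U_def R_def algebra_simps)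
  have hits: "s * (\<Sum>y\<in>F. w src y * hit s y) = D src * U"
    using hit_eq[OF root_in, of s] assms by (simp add: U_def)
  have "0 < (\<Sum>y\<in>F. w src y * hit s y)"
    using hits U D0 assms(1) by (metis mult_pos_pos zero_less_mult_pos)
  then obtain y where y: "y \<in> F" "0 < w src y * hit s y"
    by (meson not_less sum_nonpos)
  have wy: "0 < w src y" "0 < hit s y"
    using y w_nonneg[of src y] hit_nonneg[OF y(1), of s] assms by (auto simp: zero_less_mult_iff)
  have "0 < green s y"
    using green_pos_step[OF root_in y(1) wy(1)] green_root_pos assms by auto
  then have "0 < flow s y src"
    using wy assms w_sym[of y src] by (simp add: flow_def)
  also have "\<dots> \<le> (\<Sum>y\<in>F. flow s y src)"
    using y finite_F assms root_in by (intro member_le_sum) (auto intro!: flow_nonneg)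
  finally show R1: "1 < R" using inn U by (simp add: zero_less_mult_iff)
  define \<mu> where "\<mu> = (R - 1) / (D src * U)"
  have \<mu>: "0 < \<mu>" using R1 D0 U by (simp add: \<mu>_def)
  define f where "f x = green s x / hit s x" for x
  have f0: "f src = R / (D src * U)" using D0 by (simp add: f_def U_def R_def)
  have \<mu>f0: "\<mu> \<le> f src" unfolding f0 \<mu>_def using D0 U by (intro divide_right_mono) auto
  define i where "i y = flow s src y - flow s y src" for y
  have i_sum: "(\<Sum>y\<in>F. i y) = U"
    using out inn by (simp add: i_def sum_subtractf algebra_simps)
  \<comment> \<open>The tangents at the mean \<open>\<mu>\<close> sum to zero.\<close>
  have i_ln: "(\<Sum>y\<in>F. i y * ln (f y)) \<le> U * ln \<mu>"
  proof -
    have le: "i y * (ln (f y) - ln \<mu>) \<le>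
        (f src - \<mu>) / \<mu> * (flow s y src - \<mu> * (s * w src y * U * hit s y))" if y: "y \<in> F" for y
    proof (cases "0 < w src y \<and> 0 < hit s y")
      case True
      have g: "0 < green s y"
        using green_pos_step[OF root_in y, of s] True green_root_pos assms by auto
      define q where "q = s * w src y * U * hit s y"
      define Y where "Y = (f src - \<mu>) / \<mu>"
      have e: "i y = q * (f src - f y)" "flow s y src = q * f y"
        using True U by (simp_all add: q_def i_def flow_def f_def U_def[symmetric] w_sym[of y src] algebra_simps)
      have "q * ((f src - f y) * (ln (f y) - ln \<mu>)) \<le> q * (Y * (f y - \<mu>))"
        unfolding Y_def using True assms(1) U \<mu> \<mu>f0 g
        by (intro mult_left_mono entrance_inequality) (auto simp: f_def q_def)
      then have "q * (f src - f y) * (ln (f y) - ln \<mu>) \<le> Y * (q * f y - \<mu> * q)"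
        by (simp only: right_diff_distrib left_diff_distrib mult_ac)
      then show ?thesis unfolding e Y_def q_def .
    next
      case False
      then have "w src y = 0 \<or> hit s y = 0"
        using w_nonneg[of src y] hit_nonneg[OF y, of s] assms by force
      then have "flow s src y = 0" by (auto simp: flow_def)
      moreover have "flow s y src = 0"
      proof (cases "w src y = 0")
        case True then show ?thesis by (simp add: flow_def w_sym[of y src])
      next
        case nz: False
        then have "0 < w y src" using w_nonneg[of src y] w_sym[of y src] by simp
        then have "0 < hit s y" using hit_pos_step[OF y root_in] assms by auto
        then show ?thesis using False nz w_nonneg[of src y] by simp
      qed
      ultimately show ?thesis using \<open>w src y = 0 \<or> hit s y = 0\<close> by (auto simp: i_def)
    qed
    have "(\<Sum>y\<in>F. i y * (ln (f y) - ln \<mu>)) \<le>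
        (\<Sum>y\<in>F. (f src - \<mu>) / \<mu> * (flow s y src - \<mu> * (s * w src y * U * hit s y)))"
      by (intro sum_mono le)
    also have "\<dots> = (f src - \<mu>) / \<mu> * ((\<Sum>y\<in>F. flow s y src) - \<mu> * U * (s * (\<Sum>y\<in>F. w src y * hit s y)))"
      by (simp add: sum_distrib_left sum_subtractf algebra_simps)
    also have "\<dots> = 0"
      unfolding inn hits using D0 U by (simp add: \<mu>_def)
    finally show ?thesis
      using i_sum by (simp add: right_diff_distrib sum_subtractf sum_distrib_right[symmetric])
  qed
  define \<kappa> where "\<kappa> = coth_val G + coth_slope G * ln G"
  define c where "c = coth_slope G"
  have c: "0 \<le> c" unfolding c_def using coth_slope_pos[OF assms(6)] by simp
  define \<psi> where "\<psi> x = \<kappa> * real (d x) + c * ln (f x)" for x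
  \<comment> \<open>Removing the source from the vertices restarts the flow at the neighbours of the source.\<close>
  define H where "H = F - {src}"
  have H: "finite H" "F = insert src H" "src \<notin> H"
    using finite_F root_in by (auto simp: H_def)
  have inner: "(\<Sum>y\<in>H. \<psi> y * (\<Sum>x\<in>H. flow s x y - flow s y x)) \<le> (\<Sum>x\<in>H. \<Sum>y\<in>H. flow s x y)"
    unfolding \<psi>_def \<kappa>_def c_def f_def
    using flow_edge[OF assms(1,2) _ _ assms(6)] d_edge by (intro antisymmetric_sum H) (auto simp: H_def)
  have "(\<Sum>x\<in>H. flow s x y - flow s y x) = s * b y * green s y - i y" if "y \<in> H" for y
  proof -
    have "(\<Sum>x\<in>F. flow s x y - flow s y x) = s * b y * green s y"
      using that assms(1,2) by (simp add: sum_subtractf flow_in flow_out H_def)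
    then show ?thesis
      unfolding H(2) using H by (simp add: i_def)
  qed
  then have "(\<Sum>y\<in>H. \<psi> y * (\<Sum>x\<in>H. flow s x y - flow s y x)) = (\<Sum>y\<in>H. \<psi> y * (s * b y * green s y - i y))"
    by simp
  also have "\<dots> = (\<Sum>y\<in>F. \<psi> y * (s * b y * green s y - i y))"
    using H by (simp add: b_root i_def)
  also have "\<dots> = (\<Sum>y\<in>F. \<psi> y * (s * b y * green s y)) - (\<Sum>y\<in>F. \<psi> y * i y)"
    by (simp add: right_diff_distrib sum_subtractf)
  also have "(\<Sum>y\<in>F. \<psi> y * i y) = \<kappa> * (\<Sum>y\<in>F. real (d y) * i y) + c * (\<Sum>y\<in>F. i y * ln (f y))"
    by (simp add: \<psi>_def sum_distrib_left sum.distrib[symmetric] algebra_simps)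
  also have "(\<Sum>y\<in>F. real (d y) * i y) = (\<Sum>y\<in>F. i y)"
  proof (intro sum.cong refl)
    fix y assume y: "y \<in> F"
    consider "y = src" | "w src y = 0" | "y \<noteq> src" "0 < w src y"
      using w_nonneg[of src y] by linarith
    then show "real (d y) * i y = i y"
      using d_root_edge[OF y] by cases (auto simp: i_def flow_def w_sym[of y src])
  qed
  finally have "U * (\<kappa> * real n - c * ln (s\<^sup>2 * W / U)) - \<kappa> * U - c * (U * ln \<mu>) \<le> (\<Sum>x\<in>H. \<Sum>y\<in>H. flow s x y)"
    using inner exit_flow_potential[where d = d and n = n and \<kappa> = \<kappa>, OF assms(1-5) c d_exit] mult_left_mono[OF i_ln c] i_sum
    unfolding \<psi>_def f_def U_def by simp
  moreover have "(\<Sum>x\<in>F. \<Sum>y\<in>F. flow s x y) \<ge> R * U + (\<Sum>x\<in>H. \<Sum>y\<in>H. flow s x y)"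
  proof -
    have "(\<Sum>x\<in>H. \<Sum>y\<in>H. flow s x y) \<le> (\<Sum>x\<in>H. \<Sum>y\<in>F. flow s x y)"
      using assms(1,2) finite_F by (intro sum_mono sum_mono2) (auto intro!: flow_nonneg simp: H_def)
    moreover have "(\<Sum>x\<in>F. \<Sum>y\<in>F. flow s x y) = (\<Sum>y\<in>F. flow s src y) + (\<Sum>x\<in>H. \<Sum>y\<in>F. flow s x y)"
      using H by simp
    ultimately show ?thesis using out by simp
  qed
  moreover have "ln (s\<^sup>2 * W * (R - 1) / (D src * U\<^sup>2)) = ln (s\<^sup>2 * W / U) + ln \<mu>"
    unfolding \<mu>_def using assms(1,4) U R1 D0
    by (simp add: ln_mult ln_div power2_eq_square)
  ultimately show "hit s src * (1 + R + (real n - 1) * (coth_val G + coth_slope G * ln G) -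
      coth_slope G * ln (s\<^sup>2 * W * (R - 1) / (D src * (hit s src)\<^sup>2))) \<le> visits s"
    using visits_eq[OF assms(1,2)]
    unfolding U_def[symmetric] \<kappa>_def[symmetric] unfolding c_def[symmetric] by (simp add: algebra_simps)
qed

end

section \<open>Comparison with the biased walk\<close>

text \<open>
  The parametrisation of the discount by the Laplace transform \<open>\<phi>\<close> of the hitting time of the biased walk: the first
  step of that walk gives \<open>\<phi> = s * (g + \<phi>\<^sup>2) / (1 + g)\<close>. It avoids the square root in the formula for \<open>\<phi>\<close>.
\<close>

definition discount :: "real \<Rightarrow> real \<Rightarrow> real" where
  "discount g \<phi> = (1 + g) * \<phi> / (g + \<phi>\<^sup>2)"

lemma discount_bounds:
  assumes "1 < g" "0 < \<phi>" "\<phi> < 1"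
  shows "0 < discount g \<phi>" "discount g \<phi> < 1"
proof -
  show "0 < discount g \<phi>"
    using assms by (auto simp: discount_def intro!: divide_pos_pos add_pos_nonneg)
  have "0 < (1 - \<phi>) * (g - \<phi>)" using assms by simp
  then have "(1 + g) * \<phi> < g + \<phi>\<^sup>2" by (simp add: algebra_simps power2_eq_square)
  then show "discount g \<phi> < 1"
    using assms by (simp add: discount_def add_pos_nonneg)
qed

text \<open>
  The ratio \<open>\<Theta>\<close> of the two transforms is at most \<open>1 / \<phi> ^ n\<close>, hence at most 1 in the limit \<open>\<phi> \<rightarrow> 1\<close>. The
  derivative of \<open>ln \<phi>\<close> with respect to the logarithm of the discount is \<open>coth_val (g / \<phi>\<^sup>2)\<close>, so the growth condition makes \<open>\<Theta>\<close> increase wherever it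
  exceeds 1. A value above 1 would therefore be passed on to the limit: \<open>\<Theta>\<close> would have a maximum on a compact
  interval at a point where it increases.
\<close>

lemma laplace_comparison:
  fixes U S :: "real \<Rightarrow> real"
  assumes g: "1 < g"
    and der: "\<And>s. 0 < s \<Longrightarrow> s < 1 \<Longrightarrow> (U has_real_derivative S s / s) (at s)"
    and U_le: "\<And>s. 0 < s \<Longrightarrow> s < 1 \<Longrightarrow> U s \<le> s"
    and growth: "\<And>\<phi>. 0 < \<phi> \<Longrightarrow> \<phi> < 1 \<Longrightarrow> discount g \<phi> * \<phi> ^ n < U (discount g \<phi>) \<Longrightarrow>
      U (discount g \<phi>) * (1 + real n * coth_val (g / \<phi>\<^sup>2)) < S (discount g \<phi>)"
    and \<phi>: "0 < \<phi>" "\<phi> < 1"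
  shows "U (discount g \<phi>) \<le> discount g \<phi> * \<phi> ^ n"
proof (rule ccontr)
  define \<Theta> where "\<Theta> x = U (discount g x) / (discount g x * x ^ n)" for x
  note db = discount_bounds[OF g]
  assume "\<not> ?thesis"
  then have big: "1 < \<Theta> \<phi>"
    using db[OF \<phi>] \<phi> by (simp add: \<Theta>_def)
  have der_d: "(discount g has_real_derivative (1 + g) * (g - x\<^sup>2) / (g + x\<^sup>2)\<^sup>2) (at x)" for x
  proof -
    have "g + x\<^sup>2 \<noteq> 0" using g zero_le_power2[of x] by linarith
    then show ?thesis
      unfolding discount_def[abs_def]
      by (auto intro!: derivative_eq_intros simp: power2_eq_square field_simps)
  qed
  have der_\<Theta>: "\<exists>l. (\<Theta> has_real_derivative l) (at x) \<and> (1 < \<Theta> x \<longrightarrow> 0 < l)"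
    if x: "0 < x" "x < 1" for x
  proof -
    define s where "s = discount g x"
    define s' where "s' = (1 + g) * (g - x\<^sup>2) / (g + x\<^sup>2)\<^sup>2"
    have s: "0 < s" "s < 1" using db[OF x] by (simp_all add: s_def)
    have x2: "x\<^sup>2 < g" using x g power_strict_mono[of x 1 2] by simp
    have s': "0 < s'"
    proof -
      have "0 < g + x\<^sup>2" using g by (simp add: add_pos_nonneg)
      then show ?thesis unfolding s'_def using x2 g by simp
    qed
    \<comment> \<open>The biased walk tilted by the discount has the odds \<open>g / x\<^sup>2\<close>.\<close>
    have rel: "s' * coth_val (g / x\<^sup>2) = s / x"
    proof -
      have "coth_val (g / x\<^sup>2) = (g + x\<^sup>2) / (g - x\<^sup>2)"
      proof -
        have "g / x\<^sup>2 + 1 = (g + x\<^sup>2) / x\<^sup>2" "g / x\<^sup>2 - 1 = (g - x\<^sup>2) / x\<^sup>2"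
          using x by (simp_all add: field_simps)
        then show ?thesis using x by (simp add: coth_val_def)
      qed
      moreover have "(1 + g) * q / p\<^sup>2 * (p / q) = (1 + g) * x / p / x"
        if "p \<noteq> 0" "q \<noteq> 0" for p q :: real
        using that x by (simp add: power2_eq_square)
      moreover have "g + x\<^sup>2 \<noteq> 0" "g - x\<^sup>2 \<noteq> 0" using g x2 zero_le_power2[of x] by linarith+
      ultimately show ?thesis
        by (simp only: s'_def s_def discount_def)
    qed
    have d1: "((\<lambda>x. U (discount g x)) has_real_derivative S s / s * s') (at x)"
      using DERIV_chain2[OF der[OF s, unfolded s_def] der_d[of x]] by (simp add: s_def s'_def)
    have d2: "((\<lambda>x. discount g x * x ^ n) has_real_derivative s' * x ^ n + s * (real n * x ^ (n - 1))) (at x)"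
      using der_d[of x] by (auto intro!: derivative_eq_intros simp: s_def s'_def)
    have "s * x ^ n \<noteq> 0" using s x by simp
    then have D: "(\<Theta> has_real_derivative
        (S s / s * s' * (s * x ^ n) - U s * (s' * x ^ n + s * (real n * x ^ (n - 1)))) / (s * x ^ n)\<^sup>2) (at x)"
      using DERIV_divide[OF d1 d2] unfolding \<Theta>_def[abs_def] power2_eq_square s_def by blast
    have num: "S s / s * s' * (s * x ^ n) - U s * (s' * x ^ n + s * (real n * x ^ (n - 1))) =
        x ^ n * s' * (S s - U s * (1 + real n * coth_val (g / x\<^sup>2)))"
    proof -
      have pw: "real n * x ^ (n - 1) = real n * x ^ n / x"
        using x by (cases n) auto
      have a: "S s / s * s' * (s * x ^ n) = x ^ n * s' * S s"
        using s by simp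
      have b: "U s * (s' * x ^ n + s * (real n * x ^ n / x)) = x ^ n * (s' * U s + U s * real n * (s / x))"
        by (simp add: distrib_left mult_ac)
      have "S s / s * s' * (s * x ^ n) - U s * (s' * x ^ n + s * (real n * x ^ (n - 1))) =
          x ^ n * (s' * (S s - U s) - U s * real n * (s / x))"
        unfolding pw a b by (simp add: distrib_left right_diff_distrib mult_ac)
      also have "\<dots> = x ^ n * s' * (S s - U s * (1 + real n * coth_val (g / x\<^sup>2)))"
        unfolding rel[symmetric] by (simp add: algebra_simps)
      finally show ?thesis .
    qed
    have "0 < x ^ n * s' * (S s - U s * (1 + real n * coth_val (g / x\<^sup>2))) / (s * x ^ n)\<^sup>2" if "1 < \<Theta> x"
    proof -
      have "s * x ^ n < U s"
        using that s x by (simp add: \<Theta>_def s_def[symmetric])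
      then have "U s * (1 + real n * coth_val (g / x\<^sup>2)) < S s"
        using growth[OF x] by (simp add: s_def)
      then show ?thesis using s s' x by simp
    qed
    then show ?thesis using D unfolding num by blast
  qed
  have "((\<lambda>x::real. 1 / x ^ n) \<longlongrightarrow> 1 / 1 ^ n) (at_left 1)"
    by (intro tendsto_intros) auto
  then have "eventually (\<lambda>x::real. 1 / x ^ n < \<Theta> \<phi>) (at_left 1)"
    using big by (intro order_tendstoD(2)) auto
  moreover have "eventually (\<lambda>x. x \<in> {\<phi><..<1}) (at_left 1)"
    using \<phi> by (intro eventually_at_left_real)
  ultimately have "eventually (\<lambda>x. 1 / x ^ n < \<Theta> \<phi> \<and> x \<in> {\<phi><..<1}) (at_left 1)"
    by (rule eventually_conj)
  then obtain \<beta> where \<beta>: "\<phi> < \<beta>" "\<beta> < 1" "1 / \<beta> ^ n < \<Theta> \<phi>"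
    using eventually_happens[of _ "at_left (1::real)"] by auto
  have "U (discount g \<beta>) / discount g \<beta> \<le> 1"
    using U_le[of "discount g \<beta>"] db[of \<beta>] \<beta> \<phi> by simp
  then have "U (discount g \<beta>) / discount g \<beta> / \<beta> ^ n \<le> 1 / \<beta> ^ n"
    using \<beta> \<phi> by (intro divide_right_mono) auto
  then have \<Theta>\<beta>: "\<Theta> \<beta> < \<Theta> \<phi>"
    using \<beta> by (simp add: \<Theta>_def)
  have "continuous_on {\<phi>..\<beta>} \<Theta>"
  proof (rule continuous_at_imp_continuous_on, rule ballI)
    fix x assume "x \<in> {\<phi>..\<beta>}"
    then have "0 < x" "x < 1" using \<phi> \<beta> by auto
    then show "isCont \<Theta> x" using der_\<Theta>[of x] by (blast intro: DERIV_isCont)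
  qed
  then obtain x where x: "x \<in> {\<phi>..\<beta>}" "\<And>y. y \<in> {\<phi>..\<beta>} \<Longrightarrow> \<Theta> y \<le> \<Theta> x"
    using continuous_attains_sup[of "{\<phi>..\<beta>}" \<Theta>] \<beta> by auto
  have "\<Theta> \<phi> \<le> \<Theta> x" using x(2)[of \<phi>] \<beta> by simp
  then have "1 < \<Theta> x" "x \<noteq> \<beta>" using \<Theta>\<beta> big by auto
  then have "x < \<beta>" using x(1) by simp
  have "0 < x" "x < 1" using x(1) \<phi> \<beta> by auto
  from der_\<Theta>[OF this] \<open>1 < \<Theta> x\<close>
  obtain l where l: "(\<Theta> has_real_derivative l) (at x)" "0 < l" by blast
  from DERIV_pos_inc_right[OF l]
  obtain e where e: "0 < e" "\<forall>h>0. h < e \<longrightarrow> \<Theta> x < \<Theta> (x + h)" by auto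
  define h where "h = min (e / 2) (\<beta> - x)"
  have "0 < h" "h < e" "x + h \<le> \<beta>" using e(1) \<open>x < \<beta>\<close> by (auto simp: h_def min_def)
  then show False using e(2) x(1) x(2)[of "x + h"] by auto
qed

context killed_walk
begin

text \<open>
  The choice \<open>G = g / \<phi>\<^sup>2\<close> is the odds of the tilted biased walk. As long as the transform exceeds its bound, the
  argument of the logarithm is less than \<open>G ^ n\<close>, and the tangent at \<open>G\<close> leaves exactly \<open>n * coth_val G\<close>.
\<close>

lemma hit_le_resistance:
  fixes d :: "'a \<Rightarrow> nat"
  assumes "1 < g" "0 < \<phi>" "\<phi> < 1" "0 < W" "(\<Sum>x\<in>F. b x) \<le> W"
    and W: "\<And>s. 0 < s \<Longrightarrow> s < 1 \<Longrightarrow> W * green s src \<le> g ^ n"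
    and d: "d src = 0"
      "\<And>x y. x \<in> F \<Longrightarrow> y \<in> F \<Longrightarrow> 0 < w x y \<Longrightarrow> \<bar>real (d x) - real (d y)\<bar> \<le> 1"
      "\<And>x. x \<in> F \<Longrightarrow> 0 < b x \<Longrightarrow> d x = n"
  shows "hit (discount g \<phi>) src \<le> discount g \<phi> * \<phi> ^ n"
proof (rule laplace_comparison[where S = visits and U = "\<lambda>s. hit s src"])
  fix \<phi> :: real
  assume \<phi>: "0 < \<phi>" "\<phi> < 1" and less: "discount g \<phi> * \<phi> ^ n < hit (discount g \<phi>) src"
  define s where "s = discount g \<phi>"
  define G where "G = g / \<phi>\<^sup>2"
  define U where "U = hit s src"
  have s: "0 < s" "s < 1" using discount_bounds[OF assms(1) \<phi>] by (simp_all add: s_def)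
  have "\<phi>\<^sup>2 < 1" using \<phi> power_strict_mono[of \<phi> 1 2] by simp
  then have G: "1 < G" using assms(1) \<phi> by (simp add: G_def)
  have sU: "s * \<phi> ^ n < U" "0 < s * \<phi> ^ n" using less s \<phi> by (simp_all add: s_def U_def)
  then have U: "0 < U" by linarith
  have "s\<^sup>2 * W * green s src / U\<^sup>2 < G ^ n"
  proof -
    have "s\<^sup>2 * (W * green s src) \<le> s\<^sup>2 * g ^ n"
      using W[OF s] by (intro mult_left_mono) auto
    also have "\<dots> = G ^ n * (s * \<phi> ^ n)\<^sup>2"
      using \<phi> by (simp add: G_def power_divide power_mult_distrib power_mult[symmetric] mult.commute)
    also have "\<dots> < G ^ n * U\<^sup>2"
      using sU G by (intro mult_strict_left_mono power_strict_mono) auto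
    finally show ?thesis using U by (simp add: divide_less_eq mult.assoc)
  qed
  moreover have "0 < s\<^sup>2 * W * green s src / U\<^sup>2"
    using s U assms(4) green_root_pos[OF s] by simp
  ultimately have "ln (s\<^sup>2 * W * green s src / U\<^sup>2) < ln (G ^ n)"
    by simp
  then have "coth_slope G * ln (s\<^sup>2 * W * green s src / U\<^sup>2) < coth_slope G * (real n * ln G)"
    using coth_slope_pos[OF G] G by (simp add: ln_realpow)
  then have "U * (1 + real n * coth_val G) <
      U * (1 + real n * (coth_val G + coth_slope G * ln G) - coth_slope G * ln (s\<^sup>2 * W * green s src / U\<^sup>2))"
    using U by (intro mult_strict_left_mono) (auto simp: algebra_simps)
  also have "\<dots> \<le> visits s"
    using visits_ge_resistance[where d = d and n = n, OF s _ assms(4,5) G d] U by (simp add: U_def)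
  finally show "hit (discount g \<phi>) src * (1 + real n * coth_val (g / \<phi>\<^sup>2)) < visits (discount g \<phi>)"
    by (simp add: s_def U_def G_def)
qed (use assms hit_src_deriv hit_le root_in in auto)

text \<open>
  The same choice of \<open>G\<close>. The unknown number \<open>R\<close> of visits to the source enters linearly as cost and logarithmically
  as gain, and \<open>ln X \<le> X - 1\<close> balances the two.
\<close>

lemma hit_le_weight:
  fixes d :: "'a \<Rightarrow> nat"
  assumes "1 < g" "0 < \<phi>" "\<phi> < 1" "0 < W" "(\<Sum>x\<in>F. b x) \<le> W"
    and W: "2 * W / D src \<le> (1 - 1 / g)\<^sup>2 * g ^ n"
    and d: "d src = 0"
      "\<And>x y. x \<in> F \<Longrightarrow> y \<in> F \<Longrightarrow> 0 < w x y \<Longrightarrow> \<bar>real (d x) - real (d y)\<bar> \<le> 1"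
      "\<And>x. x \<in> F \<Longrightarrow> 0 < b x \<Longrightarrow> d x = n"
      "b src = 0"
      "\<And>y. y \<in> F \<Longrightarrow> y \<noteq> src \<Longrightarrow> 0 < w src y \<Longrightarrow> d y = 1"
  shows "hit (discount g \<phi>) src \<le> discount g \<phi> * \<phi> ^ n"
proof (rule laplace_comparison[where S = visits and U = "\<lambda>s. hit s src"])
  fix \<phi> :: real
  assume \<phi>: "0 < \<phi>" "\<phi> < 1" and less: "discount g \<phi> * \<phi> ^ n < hit (discount g \<phi>) src"
  define s where "s = discount g \<phi>"
  define G where "G = g / \<phi>\<^sup>2"
  define U where "U = hit s src"
  define R where "R = D src * green s src"
  define c where "c = coth_slope G"
  note D0 = D_pos[OF root_in]
  have s: "0 < s" "s < 1" using discount_bounds[OF assms(1) \<phi>] by (simp_all add: s_def)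
  have \<phi>2: "\<phi>\<^sup>2 < 1" using \<phi> power_strict_mono[of \<phi> 1 2] by simp
  then have G: "1 < G" using assms(1) \<phi> by (simp add: G_def)
  have c: "0 < c" using coth_slope_pos[OF G] by (simp add: c_def)
  have gG: "g \<le> G" using assms(1) \<phi> \<phi>2 by (simp add: G_def le_divide_eq mult_left_le)
  have sU: "s * \<phi> ^ n < U" "0 < s * \<phi> ^ n" using less s \<phi> by (simp_all add: s_def U_def)
  then have U: "0 < U" by linarith
  note vw = visits_ge_weight[where d = d and n = n, OF s _ assms(4,5) G d, folded U_def R_def, OF U]
  have R: "1 < R" by (rule vw(1))
  define X where "X = (R - 1) / c"
  have X: "0 < X" using R c by (simp add: X_def)
  have "s\<^sup>2 * W * (R - 1) / (D src * U\<^sup>2) < G ^ n / G * X"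
  proof -
    have "2 * W / D src \<le> (1 - 1 / G)\<^sup>2 * g ^ n"
    proof -
      have "0 \<le> 1 - 1 / g" "1 - 1 / g \<le> 1 - 1 / G" using assms(1) gG by (auto simp: field_simps)
      then have "(1 - 1 / g)\<^sup>2 * g ^ n \<le> (1 - 1 / G)\<^sup>2 * g ^ n"
        using assms(1) by (intro mult_right_mono power_mono) auto
      then show ?thesis using W by linarith
    qed
    also have "(1 - 1 / G)\<^sup>2 = 2 / (c * G)"
      using G by (simp add: c_def coth_slope_def field_simps power2_eq_square)
    also have "g ^ n = G ^ n * (\<phi> ^ n)\<^sup>2"
      using \<phi> by (simp add: G_def power_divide power_mult[symmetric] mult.commute)
    finally have WD: "W / D src \<le> G ^ n / (c * G) * (\<phi> ^ n)\<^sup>2" by simp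
    have "s\<^sup>2 * (R - 1) * (W / D src) \<le> s\<^sup>2 * (R - 1) * (G ^ n / (c * G) * (\<phi> ^ n)\<^sup>2)"
      using R by (intro mult_left_mono WD) auto
    also have "\<dots> = G ^ n / G * X * (s * \<phi> ^ n)\<^sup>2"
      using c by (simp add: X_def power_mult_distrib mult_ac)
    also have "\<dots> < G ^ n / G * X * U\<^sup>2"
      using sU G X by (intro mult_strict_left_mono power_strict_mono) auto
    finally have "s\<^sup>2 * W * (R - 1) / D src < G ^ n / G * X * U\<^sup>2"
      by (simp add: mult_ac)
    then have "s\<^sup>2 * W * (R - 1) / D src / U\<^sup>2 < G ^ n / G * X"
      using U by (subst pos_divide_less_eq) auto
    then show ?thesis by simp
  qed
  moreover have "0 < s\<^sup>2 * W * (R - 1) / (D src * U\<^sup>2)"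
    using s U assms(4) R D0 by simp
  ultimately have "ln (s\<^sup>2 * W * (R - 1) / (D src * U\<^sup>2)) < ln (G ^ n / G * X)"
    using G X by simp
  also have "\<dots> = (real n - 1) * ln G + ln X"
    using G X by (simp add: ln_mult ln_div ln_realpow algebra_simps)
  also have "\<dots> \<le> (real n - 1) * ln G + (X - 1)"
    using ln_le_minus_one[OF X] by simp
  finally have "c * ln (s\<^sup>2 * W * (R - 1) / (D src * U\<^sup>2)) < c * ((real n - 1) * ln G + (X - 1))"
    using c by simp
  also have "\<dots> = (real n - 1) * (c * ln G) + (R - 1) - c"
    using c by (simp add: X_def field_simps)
  finally have ln_less: "c * ln (s\<^sup>2 * W * (R - 1) / (D src * U\<^sup>2)) < (real n - 1) * (c * ln G) + (R - 1) - c" .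
  have "coth_val G \<le> 1 + c"
  proof -
    have "2 * (G - 1) / (G - 1)\<^sup>2 = 2 / (G - 1)"
      using G by (simp add: divide_simps power2_eq_square)
    then have "coth_val G = 1 + 2 * (G - 1) / (G - 1)\<^sup>2"
      using G by (simp add: coth_val_def field_simps)
    also have "\<dots> \<le> 1 + c"
      unfolding c_def coth_slope_def by (intro add_left_mono divide_right_mono) auto
    finally show ?thesis .
  qed
  then have "U * (1 + real n * coth_val G) <
      U * (1 + R + (real n - 1) * (coth_val G + c * ln G) - c * ln (s\<^sup>2 * W * (R - 1) / (D src * U\<^sup>2)))"
    using U ln_less by (intro mult_strict_left_mono) (auto simp: algebra_simps)
  also have "\<dots> \<le> visits s"
    using vw(2) by (simp add: c_def)
  finally show "hit (discount g \<phi>) src * (1 + real n * coth_val (g / \<phi>\<^sup>2)) < visits (discount g \<phi>)"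
    by (simp add: s_def U_def G_def)
qed (use assms hit_src_deriv hit_le root_in in auto)

end

lemma le_imp_inverse_ennreal:
  fixes a b :: ennreal
  assumes "a \<le> b"
  shows "inverse b \<le> inverse a"
proof (cases "a = 0 \<or> b = top")
  case False
  then obtain p q where pq: "a = ennreal p" "b = ennreal q" "0 \<le> p" "0 \<le> q"
    using assms by (cases a; cases b) (auto simp: top_unique)
  then have "0 < p" "p \<le> q" using False assms by (auto simp: less_eq_real_def)
  then show ?thesis using pq by (auto simp: inverse_ennreal intro!: ennreal_leI le_imp_inverse_le)
qed auto

section \<open>Finite parts of a weighted graph\<close>

context
  fixes w :: "'a \<Rightarrow> 'a \<Rightarrow> real"
  assumes wg: "weighted_graph w"
begin

lemma w_sym: "w x y = w y x" and w_nonneg: "0 \<le> w x y"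
  using wg unfolding weighted_graph_def by blast+

lemma w_summable: "w x summable_on A"
  using wg summable_on_subset[of "w x" UNIV A] unfolding weighted_graph_def by auto

lemma sum_le_vertex_weight: "finite Y \<Longrightarrow> (\<Sum>y\<in>Y. w x y) \<le> vertex_weight w x"
  unfolding vertex_weight_def by (intro finite_sum_le_infsum w_summable w_nonneg) auto

lemma vertex_weight_nonneg: "0 \<le> vertex_weight w x"
  using sum_le_vertex_weight[of "{}"] by simp

lemma set_weight_nonneg: "0 \<le> set_weight w z"
  unfolding set_weight_def by (intro infsum_nonneg vertex_weight_nonneg)

lemma vertex_weight_split:
  "vertex_weight w x = infsum (w x) z + infsum (w x) (- z)"
  unfolding vertex_weight_def
  using infsum_Un_disjoint[OF w_summable w_summable, of z "- z" x] by simp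

lemma exits_le_set_weight:
  assumes "finite F" "vertex_weight w summable_on z"
  shows "(\<Sum>x\<in>F. infsum (w x) z) \<le> set_weight w z"
proof -
  have "(\<Sum>x\<in>F. infsum (w x) z) = infsum (\<lambda>y. \<Sum>x\<in>F. w x y) z \<and> (\<lambda>y. \<Sum>x\<in>F. w x y) summable_on z"
    using assms(1)
  proof induction
    case (insert x F)
    then show ?case using infsum_add[OF w_summable[of x z]] summable_on_add[OF w_summable[of x z]] by simp
  qed simp
  moreover have "(\<Sum>x\<in>F. w x y) \<le> vertex_weight w y" for y
    using sum_le_vertex_weight[OF assms(1), of y] w_sym by simp
  ultimately show ?thesis
    unfolding set_weight_def using assms(2) by (auto intro: infsum_mono)
qed

lemma killed_walk_subset:
  assumes "finite F" "F \<inter> z = {}" "src \<in> F" "\<And>x. x \<in> F \<Longrightarrow> 0 < vertex_weight w x"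
  shows "killed_walk F src w (vertex_weight w) (\<lambda>x. infsum (w x) z)"
proof
  fix x
  have "(\<Sum>y\<in>F. w x y) \<le> infsum (w x) (- z)"
    using assms by (intro finite_sum_le_infsum w_summable w_nonneg) auto
  then show "(\<Sum>y\<in>F. w x y) + infsum (w x) z \<le> vertex_weight w x"
    using vertex_weight_split[of x z] by simp
  show "0 \<le> infsum (w x) z" by (intro infsum_nonneg w_nonneg)
qed (use assms w_sym w_nonneg in auto)

section \<open>Resistance\<close>

text \<open>
  The energy is a supremum of finite sums, and every finite set of edges lies in a square.
\<close>

lemma energy_le:
  assumes "finite F" "\<And>Y. finite Y \<Longrightarrow> F \<subseteq> Y \<Longrightarrow> (\<Sum>x\<in>Y. \<Sum>y\<in>Y. w x y * (f x - f y)\<^sup>2) \<le> 2 * B"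
  shows "energy w f \<le> ennreal B"
proof -
  let ?e = "\<lambda>(x, y). w x y * (f x - f y)\<^sup>2"
  have e: "0 \<le> ?e p" for p using w_nonneg by (cases p) simp
  have "(\<Sum>\<^sub>\<infinity>p\<in>UNIV. ennreal (?e p)) \<le> ennreal (2 * B)"
  proof (subst nonneg_infsum_complete, simp, rule SUP_least)
    fix P :: "('a \<times> 'a) set"
    assume "P \<in> {P. finite P \<and> P \<subseteq> UNIV}"
    then have P: "finite P" by simp
    define Y where "Y = F \<union> fst ` P \<union> snd ` P"
    have Y: "finite Y" "F \<subseteq> Y" using P assms(1) by (auto simp: Y_def)
    have "P \<subseteq> Y \<times> Y" by (force simp: Y_def)
    then have "sum ?e P \<le> sum ?e (Y \<times> Y)"
      using Y e by (intro sum_mono2) auto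
    also have "\<dots> \<le> 2 * B"
      using assms(2)[OF Y] by (simp add: sum.cartesian_product)
    finally show "(\<Sum>p\<in>P. ennreal (?e p)) \<le> ennreal (2 * B)"
      using e by (subst sum_ennreal) (auto intro!: ennreal_leI)
  qed
  then have "energy w f \<le> ennreal (2 * B) / 2"
    unfolding energy_def by (intro divide_right_mono_ennreal) (simp add: case_prod_unfold)
  also have "\<dots> = ennreal B"
    by (cases "0 \<le> B") (auto simp: ennreal_mult ennreal_neg mult.commute ennreal_mult_divide_eq)
  finally show ?thesis .
qed

text \<open>
  The test potential is the normalised Green function, extended by 0. Its energy is the quadratic form of the killed
  walk without discount, which the discount only increases.
\<close>

lemma green_le_resistance:
  assumes "finite F" "F \<inter> z = {}" "src \<in> F" "\<And>x. x \<in> F \<Longrightarrow> 0 < vertex_weight w x"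
    and "0 < s" "s < 1"
  shows "ennreal (killed_walk.green F src w (vertex_weight w) s src) \<le> eff_resistance w src z"
proof -
  interpret killed_walk F src w "vertex_weight w" "\<lambda>x. infsum (w x) z"
    by (rule killed_walk_subset) fact+
  define v where "v x = (if x \<in> F then green s x else 0)" for x
  have v: "0 \<le> v x" for x using assms by (simp add: v_def green_nonneg)
  have v0: "0 < v src" using green_root_pos assms by (simp add: v_def)
  define f where "f x = v x / v src" for x
  have "(\<Sum>x\<in>Y. \<Sum>y\<in>Y. w x y * (f x - f y)\<^sup>2) \<le> 2 * (1 / v src)" if Y: "finite Y" "F \<subseteq> Y" for Y
  proof -
    have "(\<Sum>x\<in>Y. \<Sum>y\<in>Y. w x y * (v x - v y)\<^sup>2) =
        (\<Sum>x\<in>Y. \<Sum>y\<in>Y. w x y * (v x)\<^sup>2) + (\<Sum>x\<in>Y. \<Sum>y\<in>Y. w x y * (v y)\<^sup>2) -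
        2 * (\<Sum>x\<in>Y. \<Sum>y\<in>Y. w x y * v x * v y)"
      by (simp add: sum.distrib sum_subtractf sum_distrib_left power2_diff algebra_simps)
    also have "(\<Sum>x\<in>Y. \<Sum>y\<in>Y. w x y * (v y)\<^sup>2) = (\<Sum>x\<in>Y. \<Sum>y\<in>Y. w x y * (v x)\<^sup>2)"
      by (subst sum.swap) (simp add: w_sym)
    also have "(\<Sum>x\<in>Y. \<Sum>y\<in>Y. w x y * (v x)\<^sup>2) \<le> (\<Sum>x\<in>Y. vertex_weight w x * (v x)\<^sup>2)"
      unfolding sum_distrib_right[symmetric]
      by (intro sum_mono mult_right_mono sum_le_vertex_weight Y) auto
    also have "\<dots> = (\<Sum>x\<in>F. v x * (vertex_weight w x * v x))"
      using Y by (intro sum.mono_neutral_cong_right) (auto simp: v_def power2_eq_square)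
    also have "\<dots> = (\<Sum>x\<in>F. v x * ((if x = src then 1 else 0) + s * (\<Sum>y\<in>F. w x y * v y)))"
      using green_eq assms(5,6) by (intro sum.cong) (auto simp: v_def)
    also have "\<dots> = (\<Sum>x\<in>F. v x * (if x = src then 1 else 0)) + s * (\<Sum>x\<in>F. \<Sum>y\<in>F. w x y * v x * v y)"
      by (simp add: sum.distrib sum_distrib_left algebra_simps)
    also have "(\<Sum>x\<in>F. v x * (if x = src then 1 else 0)) = v src"
      using assms by (simp add: if_distrib cong: if_cong)
    also have "s * (\<Sum>x\<in>F. \<Sum>y\<in>F. w x y * v x * v y) \<le> 1 * (\<Sum>x\<in>F. \<Sum>y\<in>F. w x y * v x * v y)"
      using assms v w_nonneg by (intro mult_right_mono sum_nonneg mult_nonneg_nonneg) auto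
    also have "(\<Sum>x\<in>F. \<Sum>y\<in>F. w x y * v x * v y) = (\<Sum>x\<in>Y. \<Sum>y\<in>Y. w x y * v x * v y)"
    proof -
      have "(\<Sum>x\<in>Y. \<Sum>y\<in>Y. w x y * v x * v y) = (\<Sum>x\<in>F. \<Sum>y\<in>Y. w x y * v x * v y)"
        using Y by (intro sum.mono_neutral_right) (auto simp: v_def)
      also have "\<dots> = (\<Sum>x\<in>F. \<Sum>y\<in>F. w x y * v x * v y)"
        using Y by (intro sum.cong sum.mono_neutral_right) (auto simp: v_def)
      finally show ?thesis by simp
    qed
    finally have "(\<Sum>x\<in>Y. \<Sum>y\<in>Y. w x y * (v x - v y)\<^sup>2) \<le> 2 * v src" by simp
    then have "(\<Sum>x\<in>Y. \<Sum>y\<in>Y. w x y * (v x - v y)\<^sup>2) / (v src)\<^sup>2 \<le> 2 * v src / (v src)\<^sup>2"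
      by (intro divide_right_mono) auto
    moreover have "(\<Sum>x\<in>Y. \<Sum>y\<in>Y. w x y * (f x - f y)\<^sup>2) = (\<Sum>x\<in>Y. \<Sum>y\<in>Y. w x y * (v x - v y)\<^sup>2) / (v src)\<^sup>2"
      by (simp add: f_def diff_divide_distrib[symmetric] power_divide sum_divide_distrib)
    ultimately show ?thesis using v0 by (simp add: power2_eq_square)
  qed
  then have "energy w f \<le> ennreal (1 / v src)"
    using assms(1) by (intro energy_le)
  moreover have "f src = 1" "\<forall>y\<in>z. f y = 0"
    using v0 assms(2) by (auto simp: f_def v_def)
  ultimately have "eff_conductance w src z \<le> ennreal (1 / v src)"
    unfolding eff_conductance_def by (intro INF_lower2[of f]) auto
  then have "inverse (ennreal (1 / v src)) \<le> eff_resistance w src z"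
    unfolding eff_resistance_def by (rule le_imp_inverse_ennreal)
  then show ?thesis
    using v0 assms by (simp add: inverse_ennreal v_def)
qed

text \<open>
  The test potential is constant off the source and the target, with the constant chosen as for two resistors with
  the conductances \<open>p\<close> and \<open>q\<close> in series. The strict inequality is what makes the growth parameter exceed 1, so that
  the biased walk drifts to the right.
\<close>

lemma weight_resistance_gt_1:
  assumes "0 < vertex_weight w src" "src \<notin> z" "\<And>y. y \<in> z \<Longrightarrow> w src y = 0"
    and "vertex_weight w summable_on z" "eff_resistance w src z < \<infinity>"
  shows "1 < set_weight w z * enn2real (eff_resistance w src z)"
proof -
  define p where "p = vertex_weight w src"
  define q where "q = set_weight w z"
  define \<theta> where "\<theta> = p / (p + q)"
  have p: "0 < p" and q: "0 \<le> q" using assms set_weight_nonneg by (auto simp: p_def q_def)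
  define f where "f x = (if x = src then 1 else if x \<in> z then 0 else \<theta>)" for x
  have "(\<Sum>x\<in>Y. \<Sum>y\<in>Y. w x y * (f x - f y)\<^sup>2) \<le> 2 * (p * q / (p + q))"
    if Y: "finite Y" "{src} \<subseteq> Y" for Y
  proof -
    define a where "a x = (if x = src then (1 - \<theta>)\<^sup>2 else if x \<in> z then \<theta>\<^sup>2 else 0)" for x
    have "w x y * (f x - f y)\<^sup>2 \<le> w x y * a x + w x y * a y" for x y
      using assms(2,3) w_sym[of x y] w_nonneg[of x y]
      by (auto simp: f_def a_def power2_commute)
    then have "(\<Sum>x\<in>Y. \<Sum>y\<in>Y. w x y * (f x - f y)\<^sup>2) \<le> (\<Sum>x\<in>Y. \<Sum>y\<in>Y. w x y * a x + w x y * a y)"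
      by (intro sum_mono)
    also have "\<dots> = 2 * (\<Sum>x\<in>Y. \<Sum>y\<in>Y. w x y * a x)"
    proof -
      have "(\<Sum>x\<in>Y. \<Sum>y\<in>Y. w x y * a y) = (\<Sum>x\<in>Y. \<Sum>y\<in>Y. w x y * a x)"
        by (subst sum.swap) (simp add: w_sym)
      then show ?thesis by (simp add: sum.distrib)
    qed
    also have "(\<Sum>x\<in>Y. \<Sum>y\<in>Y. w x y * a x) \<le> (\<Sum>x\<in>Y. vertex_weight w x * a x)"
      unfolding sum_distrib_right[symmetric]
      by (intro sum_mono mult_right_mono sum_le_vertex_weight Y) (auto simp: a_def)
    also have "\<dots> = (\<Sum>x\<in>insert src (Y \<inter> z). vertex_weight w x * a x)"
      using Y by (intro sum.mono_neutral_right) (auto simp: a_def)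
    also have "\<dots> = p * (1 - \<theta>)\<^sup>2 + (\<Sum>x\<in>Y \<inter> z. vertex_weight w x) * \<theta>\<^sup>2"
    proof -
      have "(\<Sum>x\<in>Y \<inter> z. vertex_weight w x * a x) = (\<Sum>x\<in>Y \<inter> z. vertex_weight w x * \<theta>\<^sup>2)"
        using assms(2) by (intro sum.cong) (auto simp: a_def)
      then show ?thesis
        using Y assms(2) by (simp add: p_def a_def sum_distrib_right)
    qed
    also have "(\<Sum>x\<in>Y \<inter> z. vertex_weight w x) \<le> q"
      unfolding q_def set_weight_def using Y assms(4)
      by (intro finite_sum_le_infsum vertex_weight_nonneg) auto
    also have "p * (1 - \<theta>)\<^sup>2 + q * \<theta>\<^sup>2 = p * q / (p + q)"
    proof -
      have t: "1 - \<theta> = q / (p + q)" using p q by (simp add: \<theta>_def field_simps)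
      have "p * (1 - \<theta>)\<^sup>2 + q * \<theta>\<^sup>2 = p * q * (p + q) / (p + q)\<^sup>2"
        unfolding t by (simp add: \<theta>_def power_divide add_divide_distrib[symmetric] power2_eq_square algebra_simps)
      then show ?thesis using p q by (simp add: power2_eq_square)
    qed
    finally show ?thesis by (simp add: mult_right_mono)
  qed
  then have "energy w f \<le> ennreal (p * q / (p + q))"
    by (intro energy_le[of "{src}"]) auto
  moreover have "f src = 1" "\<forall>y\<in>z. f y = 0"
    using assms(2) by (auto simp: f_def)
  ultimately have cond: "eff_conductance w src z \<le> ennreal (p * q / (p + q))"
    unfolding eff_conductance_def by (intro INF_lower2[of f]) auto
  then have res: "inverse (ennreal (p * q / (p + q))) \<le> eff_resistance w src z"
    unfolding eff_resistance_def by (rule le_imp_inverse_ennreal)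
  have "q \<noteq> 0" using res assms(5) by (auto simp: top_unique)
  then have q: "0 < q" using q by simp
  then have "ennreal ((p + q) / (p * q)) \<le> eff_resistance w src z"
    using res p by (simp add: inverse_ennreal)
  then have "(p + q) / (p * q) \<le> enn2real (eff_resistance w src z)"
    using enn2real_mono[of "ennreal ((p + q) / (p * q))"] assms(5) p q by simp
  then have "q * ((p + q) / (p * q)) \<le> q * enn2real (eff_resistance w src z)"
    using q by (intro mult_left_mono) auto
  moreover have "1 < q * ((p + q) / (p * q))" using p q by (simp add: field_simps)
  ultimately show ?thesis by (simp add: q_def)
qed

section \<open>Levels\<close>

text \<open>
  The distance from the source, cut off at \<open>n\<close>.
\<close>

definition level :: "'a \<Rightarrow> nat \<Rightarrow> 'a \<Rightarrow> nat" where
  "level src n x = (LEAST k. k = n \<or> (src, x) \<in> edges w ^^ k)"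

lemma level_cases: "level src n x = n \<or> (src, x) \<in> edges w ^^ level src n x"
  unfolding level_def by (rule LeastI[of _ n]) simp

lemma level_le: "level src n x \<le> n"
  unfolding level_def by (rule Least_le) simp

lemma level_le_path: "(src, x) \<in> edges w ^^ k \<Longrightarrow> level src n x \<le> k"
  unfolding level_def by (rule Least_le) simp

lemma level_src: "level src n src = 0"
  using level_le_path[of src src 0 n] by simp

lemma level_step: "w x y \<noteq> 0 \<Longrightarrow> level src n y \<le> level src n x + 1"
proof -
  assume "w x y \<noteq> 0"
  then have "(x, y) \<in> edges w" by (simp add: edges_def)
  then show ?thesis
    using level_cases[of src n x] level_le[of src n y]
      level_le_path[of src y "Suc (level src n x)" n] by auto
qed

lemma level_edge:
  assumes "0 < w x y"
  shows "\<bar>real (level src n x) - real (level src n y)\<bar> \<le> 1"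
  using level_step[of x y src n] level_step[of y x src n] w_sym[of x y] assms by simp

lemma level_neighbour:
  assumes "0 < n" "y \<noteq> src" "0 < w src y"
  shows "level src n y = 1"
proof -
  have "level src n y \<noteq> 0"
    using level_cases[of src n y] assms by (metis relpow_0_E less_irrefl)
  moreover have "level src n y \<le> 1"
    using level_step[of src y src n] assms level_src[of src n] by simp
  ultimately show ?thesis by simp
qed

lemma graph_dist_path:
  assumes "(src, y) \<in> edges w ^^ k" "y \<in> z"
  shows "graph_dist w src z \<le> enat k"
  unfolding graph_dist_def using assms by (intro INF_lower) auto

lemma exit_edge:
  assumes "0 < infsum (w x) z"
  obtains y where "y \<in> z" "0 < w x y"
proof -
  have "\<exists>y\<in>z. w x y \<noteq> 0" using assms infsum_0[of z "w x"] by force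
  then show ?thesis using that w_nonneg by (metis less_le)
qed

lemma level_exit:
  assumes "enat (n + 1) \<le> graph_dist w src z" "0 < infsum (w x) z"
  shows "level src n x = n"
proof (rule ccontr)
  assume ne: "level src n x \<noteq> n"
  obtain y where y: "y \<in> z" "0 < w x y" using exit_edge[OF assms(2)] .
  then have "(src, y) \<in> edges w ^^ Suc (level src n x)"
    using level_cases[of src n x] ne by (auto simp: edges_def intro!: relcompI)
  then have "enat (n + 1) \<le> enat (Suc (level src n x))"
    using graph_dist_path[OF _ y(1)] assms(1) by (metis order_trans)
  then show False using ne level_le[of src n x] by simp
qed

end

section \<open>Bounds from Laplace transforms\<close>

lemma hitting_time_eq_enat:
  "hitting_time x z = enat t \<longleftrightarrow> x t \<in> z \<and> (\<forall>i<t. x i \<notin> z)"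
proof -
  have le: "hitting_time x z \<le> enat i" if "x i \<in> z" for i
    unfolding hitting_time_def using that by (intro INF_lower) auto
  have ge: "enat t \<le> hitting_time x z" if "\<forall>i<t. x i \<notin> z" for t
    unfolding hitting_time_def using that by (intro INF_greatest) (auto simp: not_less[symmetric])
  show ?thesis
  proof
    assume eq: "hitting_time x z = enat t"
    have no: "\<forall>i<t. x i \<notin> z"
      using le eq by (metis enat_ord_simps(2) leD)
    moreover have "x t \<in> z"
    proof (rule ccontr)
      assume "x t \<notin> z"
      then have "enat (Suc t) \<le> hitting_time x z" using no by (intro ge) (auto simp: less_Suc_eq)
      then show False using eq by simp
    qed
    ultimately show "x t \<in> z \<and> (\<forall>i<t. x i \<notin> z)" by simp
  next
    assume "x t \<in> z \<and> (\<forall>i<t. x i \<notin> z)"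
    then show "hitting_time x z = enat t" using le[of t] ge[of t] by (intro antisym) auto
  qed
qed

text \<open>
  The mean dominates the secant \<open>(1 - E s\<^sup>T) / (1 - s)\<close>. Partial sums of the transform are used, since \<open>T\<close> may be
  infinite with positive probability.
\<close>

lemma (in prob_space) mean_ge_of_laplace:
  fixes T :: "'a \<Rightarrow> enat"
  assumes [measurable]: "T \<in> measurable M (count_space UNIV)"
    and s: "0 < s" "s < 1"
    and B: "\<And>m. (\<Sum>t\<le>m. s ^ t * prob {\<omega>\<in>space M. T \<omega> = enat t}) \<le> B"
  shows "ennreal ((1 - B) / (1 - s)) \<le> (\<integral>\<^sup>+\<omega>. ennreal_of_enat (T \<omega>) \<partial>M)"
proof (cases "\<integral>\<^sup>+\<omega>. ennreal_of_enat (T \<omega>) \<partial>M")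
  case (real E)
  have B0: "0 \<le> B" using B[of 0] by (simp add: order_trans[OF measure_nonneg])
  have "(1 - s ^ Suc m - B) / (1 - s) \<le> E" for m
  proof -
    let ?I = "\<lambda>t. indicator {\<omega>\<in>space M. T \<omega> = enat t} :: 'a \<Rightarrow> ennreal"
    have geo: "(1 - s ^ t) / (1 - s) \<le> real t" for t
    proof -
      have "(1 - s ^ t) / (1 - s) = (\<Sum>i<t. s ^ i)"
        using s by (simp add: sum_gp_strict)
      also have "\<dots> \<le> (\<Sum>i<t. 1)" using s by (intro sum_mono power_le_one) auto
      finally show ?thesis by simp
    qed
    have pw: "ennreal ((1 - s ^ Suc m) / (1 - s)) \<le>
        ennreal_of_enat (T \<omega>) + (\<Sum>t\<le>m. ennreal (s ^ t / (1 - s)) * ?I t \<omega>)"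
      if \<omega>: "\<omega> \<in> space M" for \<omega>
    proof (cases "\<exists>t\<le>m. T \<omega> = enat t")
      case True
      then obtain t where t: "t \<le> m" "T \<omega> = enat t" by blast
      have "(1 - s ^ Suc m) / (1 - s) \<le> 1 / (1 - s)"
        using s by (intro divide_right_mono) auto
      also have "\<dots> = (1 - s ^ t) / (1 - s) + s ^ t / (1 - s)"
        by (simp add: add_divide_distrib[symmetric])
      also have "\<dots> \<le> real t + s ^ t / (1 - s)" using geo[of t] by simp
      finally have "ennreal ((1 - s ^ Suc m) / (1 - s)) \<le> ennreal (real t + s ^ t / (1 - s))"
        by (rule ennreal_leI)
      also have "\<dots> = ennreal_of_enat (T \<omega>) + ennreal (s ^ t / (1 - s)) * ?I t \<omega>"
        using t s \<omega> by (subst ennreal_plus) (auto simp: ennreal_of_nat_eq_real_of_nat)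
      also have "\<dots> \<le> ennreal_of_enat (T \<omega>) + (\<Sum>t\<le>m. ennreal (s ^ t / (1 - s)) * ?I t \<omega>)"
        using t by (intro add_left_mono member_le_sum) auto
      finally show ?thesis .
    next
      case False
      have "enat (Suc m) \<le> T \<omega>"
      proof (cases "T \<omega>")
        case (enat k)
        then show ?thesis using False by (auto simp: not_le)
      qed simp
      then have "ennreal_of_enat (enat (Suc m)) \<le> ennreal_of_enat (T \<omega>)"
        by (simp only: ennreal_of_enat_le_iff)
      moreover have "ennreal ((1 - s ^ Suc m) / (1 - s)) \<le> ennreal (real (Suc m))"
        by (intro ennreal_leI geo)
      ultimately have "ennreal ((1 - s ^ Suc m) / (1 - s)) \<le> ennreal_of_enat (T \<omega>)"
        by (simp add: ennreal_of_nat_eq_real_of_nat)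
      then show ?thesis by (simp add: add_increasing2)
    qed
    have "ennreal ((1 - s ^ Suc m) / (1 - s)) = (\<integral>\<^sup>+\<omega>. ennreal ((1 - s ^ Suc m) / (1 - s)) \<partial>M)"
      by (simp add: emeasure_space_1)
    also have "\<dots> \<le> (\<integral>\<^sup>+\<omega>. ennreal_of_enat (T \<omega>) + (\<Sum>t\<le>m. ennreal (s ^ t / (1 - s)) * ?I t \<omega>) \<partial>M)"
      by (intro nn_integral_mono pw)
    also have "\<dots> = ennreal E + (\<Sum>t\<le>m. ennreal (s ^ t / (1 - s)) * emeasure M {\<omega>\<in>space M. T \<omega> = enat t})"
    proof -
      have "(\<integral>\<^sup>+\<omega>. (\<Sum>t\<le>m. ennreal (s ^ t / (1 - s)) * ?I t \<omega>) \<partial>M) =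
          (\<Sum>t\<le>m. ennreal (s ^ t / (1 - s)) * emeasure M {\<omega>\<in>space M. T \<omega> = enat t})"
        by (subst nn_integral_sum) (auto intro!: sum.cong nn_integral_cmult_indicator)
      then show ?thesis
        using real by (subst nn_integral_add) auto
    qed
    also have "(\<Sum>t\<le>m. ennreal (s ^ t / (1 - s)) * emeasure M {\<omega>\<in>space M. T \<omega> = enat t}) =
        ennreal (\<Sum>t\<le>m. s ^ t / (1 - s) * prob {\<omega>\<in>space M. T \<omega> = enat t})"
      using s by (simp add: emeasure_eq_measure ennreal_mult[symmetric] sum_ennreal)
    also have "(\<Sum>t\<le>m. s ^ t / (1 - s) * prob {\<omega>\<in>space M. T \<omega> = enat t}) =
        (\<Sum>t\<le>m. s ^ t * prob {\<omega>\<in>space M. T \<omega> = enat t}) / (1 - s)"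
      by (simp add: sum_divide_distrib)
    also have "ennreal E + ennreal (\<dots>) \<le> ennreal E + ennreal (B / (1 - s))"
      using s B by (intro add_left_mono ennreal_leI divide_right_mono) auto
    also have "\<dots> = ennreal (E + B / (1 - s))"
      using real s B0 by (simp add: ennreal_plus)
    finally have "(1 - s ^ Suc m) / (1 - s) \<le> E + B / (1 - s)"
      using real s B0 by (subst (asm) ennreal_le_iff) auto
    then show ?thesis by (simp add: diff_divide_distrib)
  qed
  moreover have "(\<lambda>m. (1 - s ^ Suc m - B) / (1 - s)) \<longlonglongrightarrow> (1 - 0 - B) / (1 - s)"
    using s by (intro tendsto_intros LIMSEQ_Suc[OF LIMSEQ_power_zero]) auto
  ultimately have "(1 - B) / (1 - s) \<le> E"
    by (intro LIMSEQ_le_const2[of _ _ E]) auto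
  then show ?thesis using real by (simp add: ennreal_leI)
qed simp

lemma (in prob_space) tail_le_of_laplace:
  fixes T :: "'a \<Rightarrow> enat"
  assumes [measurable]: "T \<in> measurable M (count_space UNIV)"
    and s: "0 < s" "s < 1" and c: "0 \<le> c"
    and B: "\<And>m. (\<Sum>t\<le>m. s ^ t * prob {\<omega>\<in>space M. T \<omega> = enat t}) \<le> B"
  shows "s powr c * prob {\<omega>\<in>space M. ereal_of_enat (T \<omega>) \<le> ereal c} \<le> B"
proof -
  define m where "m = nat \<lfloor>c\<rfloor>"
  have m: "t \<le> m \<longleftrightarrow> real t \<le> c" for t
    using c by (simp add: m_def le_nat_iff le_floor_iff)
  have "{\<omega>\<in>space M. ereal_of_enat (T \<omega>) \<le> ereal c} = (\<Union>t\<in>{..m}. {\<omega>\<in>space M. T \<omega> = enat t})"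
  proof (intro set_eqI)
    fix \<omega>
    show "\<omega> \<in> {\<omega>\<in>space M. ereal_of_enat (T \<omega>) \<le> ereal c} \<longleftrightarrow> \<omega> \<in> (\<Union>t\<in>{..m}. {\<omega>\<in>space M. T \<omega> = enat t})"
      by (cases "T \<omega>") (auto simp: m)
  qed
  also have "prob \<dots> = (\<Sum>t\<le>m. prob {\<omega>\<in>space M. T \<omega> = enat t})"
    by (intro finite_measure_finite_Union) (auto simp: disjoint_family_on_def)
  finally have "s powr c * prob {\<omega>\<in>space M. ereal_of_enat (T \<omega>) \<le> ereal c} =
      (\<Sum>t\<le>m. s powr c * prob {\<omega>\<in>space M. T \<omega> = enat t})"
    by (simp add: sum_distrib_left)
  also have "\<dots> \<le> (\<Sum>t\<le>m. s ^ t * prob {\<omega>\<in>space M. T \<omega> = enat t})"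
  proof (intro sum_mono mult_right_mono)
    fix t assume "t \<in> {..m}"
    then have "s powr c \<le> s powr real t" using s m by (intro powr_mono') auto
    then show "s powr c \<le> s ^ t" using s by (simp add: powr_realpow)
  qed simp
  also have "\<dots> \<le> B" by (rule B)
  finally show ?thesis .
qed

section \<open>Random walks\<close>

locale graph_walk =
  fixes w :: "'a \<Rightarrow> 'a \<Rightarrow> real" and src :: 'a and M :: "'b measure" and X :: "nat \<Rightarrow> 'b \<Rightarrow> 'a"
  assumes wg: "weighted_graph w"
    and src_weight: "0 < vertex_weight w src"
    and walk: "random_walk w src M X"
begin

sublocale prob_space M
  using walk unfolding random_walk_def by blast

lemma X_measurable [measurable]: "X t \<in> measurable M (count_space UNIV)"
  using walk unfolding random_walk_def by blast

lemma X_sets: "{\<omega>\<in>space M. X t \<omega> \<in> A} \<in> sets M"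
  using measurable_sets[OF X_measurable, of A t] by (simp add: vimage_def Int_def conj_commute)

lemma X_pred [measurable]: "Measurable.pred M (\<lambda>\<omega>. X t \<omega> \<in> A)"
  unfolding pred_def by (rule X_sets)

lemma X_pred_eq [measurable]: "Measurable.pred M (\<lambda>\<omega>. X t \<omega> = x)"
  using X_pred[of t "{x}"] by simp

lemma start_prob: "prob {\<omega>\<in>space M. X 0 \<omega> = src} = 1"
  using walk unfolding random_walk_def by blast

lemma path_step:
  "prob {\<omega>\<in>space M. (\<forall>i\<le>t. X i \<omega> = p i) \<and> X (Suc t) \<omega> = y} =
    prob {\<omega>\<in>space M. \<forall>i\<le>t. X i \<omega> = p i} * (w (p t) y / vertex_weight w (p t))"
  using walk unfolding random_walk_def by blast

text \<open>
  The Markov property of a random walk is given for single paths, which for an uncountable graph cannot be summed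
  freely. Restricting the walk to a finite set leaves finitely many paths.
\<close>

definition stay :: "'a set \<Rightarrow> nat \<Rightarrow> 'a \<Rightarrow> 'b set" where
  "stay F t x = {\<omega>\<in>space M. (\<forall>i\<le>t. X i \<omega> \<in> F) \<and> X t \<omega> = x}"

lemma stay_sets [measurable]: "stay F t x \<in> sets M"
  unfolding stay_def by measurable

lemma stay_step:
  assumes "finite F"
  shows "prob {\<omega>\<in>stay F t x. X (Suc t) \<omega> = y} = prob (stay F t x) * (w x y / vertex_weight w x)"
proof -
  define P where "P = {p \<in> {..t} \<rightarrow>\<^sub>E F. p t = x}"
  have fin: "finite P" unfolding P_def using assms by (intro finite_subset[OF _ finite_PiE[of "{..t}" "\<lambda>_. F"]]) auto
  have cover: "stay F t x = (\<Union>p\<in>P. {\<omega>\<in>space M. \<forall>i\<le>t. X i \<omega> = p i})"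
  proof (intro set_eqI iffI)
    fix \<omega> assume "\<omega> \<in> stay F t x"
    then show "\<omega> \<in> (\<Union>p\<in>P. {\<omega>\<in>space M. \<forall>i\<le>t. X i \<omega> = p i})"
      by (intro UN_I[of "restrict (\<lambda>i. X i \<omega>) {..t}"]) (auto simp: stay_def P_def)
  qed (auto simp: stay_def P_def)
  have disj: "p = q" if "p \<in> P" "q \<in> P" "\<forall>i\<le>t. X i \<omega> = p i" "\<forall>i\<le>t. X i \<omega> = q i" for p q \<omega>
    using that by (intro PiE_ext[of p "{..t}" "\<lambda>_. F" q]) (auto simp: P_def)
  have "{\<omega>\<in>stay F t x. X (Suc t) \<omega> = y} =
      (\<Union>p\<in>P. {\<omega>\<in>space M. (\<forall>i\<le>t. X i \<omega> = p i) \<and> X (Suc t) \<omega> = y})"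
    unfolding cover by auto
  also have "prob \<dots> = (\<Sum>p\<in>P. prob {\<omega>\<in>space M. (\<forall>i\<le>t. X i \<omega> = p i) \<and> X (Suc t) \<omega> = y})"
  proof (rule finite_measure_finite_Union[OF fin])
    show "disjoint_family_on (\<lambda>p. {\<omega>\<in>space M. (\<forall>i\<le>t. X i \<omega> = p i) \<and> X (Suc t) \<omega> = y}) P"
      unfolding disjoint_family_on_def using disj by blast
  qed auto
  also have "\<dots> = (\<Sum>p\<in>P. prob {\<omega>\<in>space M. \<forall>i\<le>t. X i \<omega> = p i} * (w x y / vertex_weight w x))"
    unfolding path_step by (intro sum.cong) (auto simp: P_def)
  also have "\<dots> = (\<Sum>p\<in>P. prob {\<omega>\<in>space M. \<forall>i\<le>t. X i \<omega> = p i}) * (w x y / vertex_weight w x)"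
    by (simp only: sum_distrib_right)
  also have "(\<Sum>p\<in>P. prob {\<omega>\<in>space M. \<forall>i\<le>t. X i \<omega> = p i}) = prob (stay F t x)"
    unfolding cover
  proof (rule finite_measure_finite_Union[OF fin, symmetric])
    show "disjoint_family_on (\<lambda>p. {\<omega>\<in>space M. \<forall>i\<le>t. X i \<omega> = p i}) P"
      unfolding disjoint_family_on_def using disj by blast
  qed auto
  finally show ?thesis .
qed

lemma stay_step_set:
  assumes "finite F" "finite Y"
  shows "prob {\<omega>\<in>stay F t x. X (Suc t) \<omega> \<in> Y} = prob (stay F t x) * ((\<Sum>y\<in>Y. w x y) / vertex_weight w x)"
proof -
  have "{\<omega>\<in>stay F t x. X (Suc t) \<omega> \<in> Y} = (\<Union>y\<in>Y. {\<omega>\<in>stay F t x. X (Suc t) \<omega> = y})" by auto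
  also have "prob \<dots> = (\<Sum>y\<in>Y. prob {\<omega>\<in>stay F t x. X (Suc t) \<omega> = y})"
    using assms by (intro finite_measure_finite_Union) (auto simp: disjoint_family_on_def)
  finally show ?thesis
    by (simp add: stay_step[OF assms(1)] sum_distrib_left sum_divide_distrib)
qed

text \<open>
  The target may be uncountable, so the probability of the complement is bounded from below by finite sums.
\<close>

lemma stay_exit:
  assumes "finite F" "0 < vertex_weight w x"
  shows "prob {\<omega>\<in>stay F t x. X (Suc t) \<omega> \<in> z} \<le> prob (stay F t x) * (infsum (w x) z / vertex_weight w x)"
proof (cases "prob (stay F t x) = 0")
  case True
  have "prob {\<omega>\<in>stay F t x. X (Suc t) \<omega> \<in> z} \<le> prob (stay F t x)"
    by (intro finite_measure_mono) auto
  then show ?thesis using True by simp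
next
  case False
  define q where "q = prob (stay F t x)"
  define e where "e = prob {\<omega>\<in>stay F t x. X (Suc t) \<omega> \<in> z}"
  define D where "D = vertex_weight w x"
  have q: "0 < q" using False by (simp add: q_def zero_less_measure_iff)
  have D: "0 < D" using assms by (simp add: D_def)
  have "infsum (w x) (- z) \<le> (q - e) * D / q"
  proof (rule infsum_le_finite_sums[OF w_summable[OF wg]])
    fix Y assume Y: "finite Y" "Y \<subseteq> - z"
    have "q * ((\<Sum>y\<in>Y. w x y) / D) = prob {\<omega>\<in>stay F t x. X (Suc t) \<omega> \<in> Y}"
      using stay_step_set[OF assms(1) Y(1)] by (simp add: q_def D_def)
    also have "\<dots> \<le> prob (stay F t x - {\<omega>\<in>stay F t x. X (Suc t) \<omega> \<in> z})"
      using Y by (intro finite_measure_mono) auto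
    also have "\<dots> = q - e"
      unfolding q_def e_def by (intro finite_measure_Diff) auto
    finally show "(\<Sum>y\<in>Y. w x y) \<le> (q - e) * D / q"
      using q D by (simp add: field_simps)
  qed
  then have "D - infsum (w x) z \<le> (q - e) * D / q"
    using vertex_weight_split[OF wg, of x z] by (simp add: D_def)
  then show ?thesis
    using q D unfolding q_def[symmetric] e_def[symmetric] D_def[symmetric] by (simp add: field_simps)
qed

lemma stay_eq_iter:
  assumes "killed_walk F src w (vertex_weight w) b" "x \<in> F"
  shows "prob (stay F t x) = vertex_weight w x *
    killed_walk.iter F w (vertex_weight w) (\<lambda>x. if x = src then 1 / vertex_weight w src else 0) t x"
  using assms(2)
proof (induction t arbitrary: x)
  interpret killed_walk F src w "vertex_weight w" b by fact
  case 0
  have "prob (stay F 0 x) = (if x = src then 1 else 0)"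
  proof (cases "x = src")
    case True
    then have "stay F 0 x = {\<omega>\<in>space M. X 0 \<omega> = src}"
      using 0 by (auto simp: stay_def)
    then show ?thesis using start_prob True by simp
  next
    case False
    have "prob (stay F 0 x) \<le> prob (space M - {\<omega>\<in>space M. X 0 \<omega> = src})"
      using False by (intro finite_measure_mono) (auto simp: stay_def)
    also have "\<dots> = 0" using start_prob by (subst prob_compl) auto
    finally show ?thesis using False by (simp add: measure_le_0_iff)
  qed
  then show ?case using src_weight by simp
next
  interpret killed_walk F src w "vertex_weight w" b by fact
  case (Suc t)
  have "stay F (Suc t) x = (\<Union>y\<in>F. {\<omega>\<in>stay F t y. X (Suc t) \<omega> = x})"
    using Suc.prems by (auto simp: stay_def le_Suc_eq)
  also have "prob \<dots> = (\<Sum>y\<in>F. prob {\<omega>\<in>stay F t y. X (Suc t) \<omega> = x})"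
    using finite_F by (intro finite_measure_finite_Union) (auto simp: disjoint_family_on_def stay_def)
  also have "\<dots> = (\<Sum>y\<in>F. w x y * iter (\<lambda>x. if x = src then 1 / vertex_weight w src else 0) t y)"
  proof (intro sum.cong refl)
    fix y assume y: "y \<in> F"
    show "prob {\<omega>\<in>stay F t y. X (Suc t) \<omega> = x} =
        w x y * iter (\<lambda>x. if x = src then 1 / vertex_weight w src else 0) t y"
      unfolding stay_step[OF finite_F] Suc.IH[OF y] using D_pos[OF y] by (simp add: w_sym[of x y])
  qed
  finally show ?case using D_pos[OF Suc.prems] by simp
qed

lemma exit_probabilities_le_hit:
  assumes "finite F" "F \<inter> z = {}" "src \<in> F" "\<And>x. x \<in> F \<Longrightarrow> 0 < vertex_weight w x"
    and s: "0 < s" "s < 1"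
  shows "(\<Sum>t<m. s ^ Suc t * prob {\<omega>\<in>space M. (\<forall>i\<le>t. X i \<omega> \<in> F) \<and> X (Suc t) \<omega> \<in> z}) \<le>
    killed_walk.hit F w (vertex_weight w) (\<lambda>x. infsum (w x) z) s src"
proof -
  interpret killed_walk F src w "vertex_weight w" "\<lambda>x. infsum (w x) z"
    using assms by (intro killed_walk_subset wg) auto
  let ?\<delta> = "\<lambda>x. if x = src then 1 / vertex_weight w src else 0"
  have \<delta>: "0 \<le> ?\<delta> x" for x using src_weight by simp
  have it: "0 \<le> iter ?\<delta> t x" if "x \<in> F" for t x
    using iter_bounds[of ?\<delta> "1 / vertex_weight w src" x t] that src_weight by auto
  have exit: "prob {\<omega>\<in>space M. (\<forall>i\<le>t. X i \<omega> \<in> F) \<and> X (Suc t) \<omega> \<in> z} \<le>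
      (\<Sum>x\<in>F. infsum (w x) z * iter ?\<delta> t x)" for t
  proof -
    have "{\<omega>\<in>space M. (\<forall>i\<le>t. X i \<omega> \<in> F) \<and> X (Suc t) \<omega> \<in> z} = (\<Union>x\<in>F. {\<omega>\<in>stay F t x. X (Suc t) \<omega> \<in> z})"
      by (auto simp: stay_def)
    also have "prob \<dots> = (\<Sum>x\<in>F. prob {\<omega>\<in>stay F t x. X (Suc t) \<omega> \<in> z})"
      using finite_F by (intro finite_measure_finite_Union) (auto simp: disjoint_family_on_def stay_def)
    also have "\<dots> \<le> (\<Sum>x\<in>F. infsum (w x) z * iter ?\<delta> t x)"
    proof (intro sum_mono)
      fix x assume x: "x \<in> F"
      then show "prob {\<omega>\<in>stay F t x. X (Suc t) \<omega> \<in> z} \<le> infsum (w x) z * iter ?\<delta> t x"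
        using stay_exit[OF finite_F D_pos[OF x], of t z] D_pos[OF x]
        unfolding stay_eq_iter[OF killed_walk_axioms x] by (simp add: mult.commute)
    qed
    finally show ?thesis .
  qed
  have "(\<Sum>t<m. s ^ Suc t * prob {\<omega>\<in>space M. (\<forall>i\<le>t. X i \<omega> \<in> F) \<and> X (Suc t) \<omega> \<in> z}) \<le>
      (\<Sum>t<m. s ^ Suc t * (\<Sum>x\<in>F. infsum (w x) z * iter ?\<delta> t x))"
    using s exit by (intro sum_mono mult_left_mono) auto
  also have "\<dots> = s * (\<Sum>x\<in>F. infsum (w x) z * (\<Sum>t<m. iter ?\<delta> t x * s ^ t))"
    unfolding sum_distrib_left by (subst sum.swap) (simp add: mult_ac)
  also have "\<dots> \<le> s * (\<Sum>x\<in>F. infsum (w x) z * green s x)"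
    unfolding green_def resolvent_def using s b_nonneg iter_summable[of ?\<delta>] \<delta> it
    by (intro mult_left_mono sum_mono sum_le_suminf) auto
  also have "\<dots> = hit s src"
    using hit_src_eq[OF s] by (simp add: mult.commute)
  finally show ?thesis .
qed

text \<open>
  Finitely many steps of the walk stay in a finite set up to probability \<open>\<epsilon>\<close>, because the step distribution at each
  of finitely many vertices is nearly carried by a finite set.
\<close>

lemma walk_tight:
  assumes "0 < \<epsilon>"
  shows "\<exists>F. finite F \<and> src \<in> F \<and> (\<forall>x\<in>F. 0 < vertex_weight w x) \<and>
    1 - \<epsilon> \<le> prob {\<omega>\<in>space M. \<forall>i\<le>t. X i \<omega> \<in> F}"
  using assms
proof (induction t arbitrary: \<epsilon>)
  case 0
  then show ?case using start_prob src_weight by (intro exI[of _ "{src}"]) simp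
next
  case (Suc t)
  define \<delta> where "\<delta> = min 1 \<epsilon> / 2"
  have \<delta>: "0 < \<delta>" "\<delta> \<le> 1 / 2" "2 * \<delta> \<le> \<epsilon>" using Suc.prems by (auto simp: \<delta>_def)
  from Suc.IH[OF \<delta>(1)] obtain F where F: "finite F" "src \<in> F" "\<forall>x\<in>F. 0 < vertex_weight w x"
    "1 - \<delta> \<le> prob {\<omega>\<in>space M. \<forall>i\<le>t. X i \<omega> \<in> F}" by blast
  have "\<exists>Y. finite Y \<and> (\<forall>y\<in>Y. 0 < vertex_weight w y) \<and> (1 - \<delta>) * vertex_weight w x \<le> (\<Sum>y\<in>Y. w x y)"
    if x: "x \<in> F" for x
  proof -
    have "0 < \<delta> * vertex_weight w x" using \<delta> F(3) x by simp
    from infsum_finite_approximation[OF w_summable[OF wg, of x UNIV] this]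
    obtain Y where Y: "finite Y" "dist (sum (w x) Y) (vertex_weight w x) \<le> \<delta> * vertex_weight w x"
      unfolding vertex_weight_def by auto
    define Y' where "Y' = {y \<in> Y. w x y \<noteq> 0}"
    have "sum (w x) Y' = sum (w x) Y"
      unfolding Y'_def using Y by (intro sum.mono_neutral_left) auto
    then have "(1 - \<delta>) * vertex_weight w x \<le> sum (w x) Y'"
      using Y(2) by (simp add: dist_real_def algebra_simps abs_le_iff)
    moreover have "0 < vertex_weight w y" if "y \<in> Y'" for y
    proof -
      have "0 < w x y" using that w_nonneg[OF wg, of x y] by (auto simp: Y'_def)
      then show ?thesis
        using sum_le_vertex_weight[OF wg, of "{x}" y] w_sym[OF wg, of x y] by simp
    qed
    ultimately show ?thesis using Y(1) by (intro exI[of _ Y']) (auto simp: Y'_def)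
  qed
  then obtain Y where Y: "\<And>x. x \<in> F \<Longrightarrow> finite (Y x)" "\<And>x y. x \<in> F \<Longrightarrow> y \<in> Y x \<Longrightarrow> 0 < vertex_weight w y"
    "\<And>x. x \<in> F \<Longrightarrow> (1 - \<delta>) * vertex_weight w x \<le> (\<Sum>y\<in>Y x. w x y)"
    by metis
  define F' where "F' = F \<union> (\<Union>x\<in>F. Y x)"
  have F': "finite F'" using F Y by (auto simp: F'_def)
  have "(1 - \<delta>) * (1 - \<delta>) \<le> (1 - \<delta>) * prob {\<omega>\<in>space M. \<forall>i\<le>t. X i \<omega> \<in> F}"
    using F(4) \<delta> by (intro mult_left_mono) auto
  also have "{\<omega>\<in>space M. \<forall>i\<le>t. X i \<omega> \<in> F} = (\<Union>x\<in>F. stay F t x)"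
    by (auto simp: stay_def)
  also have "prob \<dots> = (\<Sum>x\<in>F. prob (stay F t x))"
    using F by (intro finite_measure_finite_Union) (auto simp: disjoint_family_on_def stay_def)
  also have "(1 - \<delta>) * \<dots> \<le> (\<Sum>x\<in>F. prob {\<omega>\<in>stay F t x. X (Suc t) \<omega> \<in> F'})"
    unfolding sum_distrib_left
  proof (intro sum_mono)
    fix x assume x: "x \<in> F"
    have "(1 - \<delta>) * vertex_weight w x \<le> (\<Sum>y\<in>Y x. w x y)" using Y x by simp
    also have "\<dots> \<le> (\<Sum>y\<in>F'. w x y)"
      using F' x by (intro sum_mono2 w_nonneg[OF wg]) (auto simp: F'_def)
    finally have "1 - \<delta> \<le> (\<Sum>y\<in>F'. w x y) / vertex_weight w x"
      using F(3) x by (simp add: le_divide_eq)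
    then have "prob (stay F t x) * (1 - \<delta>) \<le> prob (stay F t x) * ((\<Sum>y\<in>F'. w x y) / vertex_weight w x)"
      by (intro mult_left_mono) auto
    then show "(1 - \<delta>) * prob (stay F t x) \<le> prob {\<omega>\<in>stay F t x. X (Suc t) \<omega> \<in> F'}"
      by (simp add: stay_step_set[OF F(1) F'] mult.commute)
  qed
  also have "\<dots> = prob (\<Union>x\<in>F. {\<omega>\<in>stay F t x. X (Suc t) \<omega> \<in> F'})"
    using F by (intro finite_measure_finite_Union[symmetric]) (auto simp: disjoint_family_on_def stay_def)
  also have "\<dots> \<le> prob {\<omega>\<in>space M. \<forall>i\<le>Suc t. X i \<omega> \<in> F'}"
  proof (rule finite_measure_mono)
    show "(\<Union>x\<in>F. {\<omega>\<in>stay F t x. X (Suc t) \<omega> \<in> F'}) \<subseteq> {\<omega>\<in>space M. \<forall>i\<le>Suc t. X i \<omega> \<in> F'}"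
      unfolding stay_def F'_def by (auto elim: le_SucE)
    show "{\<omega>\<in>space M. \<forall>i\<le>Suc t. X i \<omega> \<in> F'} \<in> sets M" by measurable
  qed
  finally have "(1 - \<delta>) * (1 - \<delta>) \<le> prob {\<omega>\<in>space M. \<forall>i\<le>Suc t. X i \<omega> \<in> F'}" .
  moreover have "1 - \<epsilon> \<le> (1 - \<delta>) * (1 - \<delta>)"
  proof -
    have "(1 - \<delta>) * (1 - \<delta>) = 1 - 2 * \<delta> + \<delta>\<^sup>2"
      by (simp add: power2_eq_square algebra_simps)
    then show ?thesis using \<delta>(3) zero_le_power2[of \<delta>] by linarith
  qed
  moreover have "\<forall>x\<in>F'. 0 < vertex_weight w x" "src \<in> F'"
    using F Y by (auto simp: F'_def)
  ultimately show ?case using F' by (intro exI[of _ F']) auto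
qed

lemma hitting_time_measurable [measurable]:
  "(\<lambda>\<omega>. hitting_time (\<lambda>t. X t \<omega>) z) \<in> measurable M (count_space UNIV)"
proof (subst measurable_count_space_eq_countable, simp, intro conjI ballI)
  show "(\<lambda>\<omega>. hitting_time (\<lambda>t. X t \<omega>) z) \<in> space M \<rightarrow> UNIV" by simp
next
  have fin: "(\<lambda>\<omega>. hitting_time (\<lambda>t. X t \<omega>) z) -` {enat t} \<inter> space M \<in> sets M" for t
  proof -
    have "(\<lambda>\<omega>. hitting_time (\<lambda>t. X t \<omega>) z) -` {enat t} \<inter> space M =
        {\<omega>\<in>space M. X t \<omega> \<in> z \<and> (\<forall>i<t. X i \<omega> \<notin> z)}"
      by (auto simp: hitting_time_eq_enat)
    also have "\<dots> \<in> sets M" by measurable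
    finally show ?thesis .
  qed
  fix k :: enat
  show "(\<lambda>\<omega>. hitting_time (\<lambda>t. X t \<omega>) z) -` {k} \<inter> space M \<in> sets M"
  proof (cases k)
    case (enat t) then show ?thesis using fin by simp
  next
    case infinity
    have "(\<lambda>\<omega>. hitting_time (\<lambda>t. X t \<omega>) z) -` {\<infinity>} \<inter> space M =
        space M - (\<Union>t. (\<lambda>\<omega>. hitting_time (\<lambda>t. X t \<omega>) z) -` {enat t} \<inter> space M)"
    proof (intro set_eqI)
      fix \<omega>
      show "\<omega> \<in> (\<lambda>\<omega>. hitting_time (\<lambda>t. X t \<omega>) z) -` {\<infinity>} \<inter> space M \<longleftrightarrow>
          \<omega> \<in> space M - (\<Union>t. (\<lambda>\<omega>. hitting_time (\<lambda>t. X t \<omega>) z) -` {enat t} \<inter> space M)"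
        by (cases "hitting_time (\<lambda>t. X t \<omega>) z") auto
    qed
    also have "\<dots> \<in> sets M" using fin by (intro sets.Diff sets.top sets.countable_UN) auto
    finally show ?thesis using infinity by simp
  qed
qed

lemma laplace_le:
  assumes "src \<notin> z" and s: "0 < s" "s < 1"
    and B: "\<And>F. finite F \<Longrightarrow> F \<inter> z = {} \<Longrightarrow> src \<in> F \<Longrightarrow> (\<And>x. x \<in> F \<Longrightarrow> 0 < vertex_weight w x) \<Longrightarrow>
      killed_walk.hit F w (vertex_weight w) (\<lambda>x. infsum (w x) z) s src \<le> B"
  shows "(\<Sum>t\<le>m. s ^ t * prob {\<omega>\<in>space M. hitting_time (\<lambda>t. X t \<omega>) z = enat t}) \<le> B"
proof (rule field_le_epsilon)
  fix \<epsilon> :: real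
  assume \<epsilon>: "0 < \<epsilon>"
  let ?T = "\<lambda>\<omega>. hitting_time (\<lambda>t. X t \<omega>) z"
  define \<delta> where "\<delta> = \<epsilon> / (real m + 1)"
  have \<delta>: "0 < \<delta>" using \<epsilon> by (simp add: \<delta>_def)
  obtain F where F: "finite F" "src \<in> F" "\<forall>x\<in>F. 0 < vertex_weight w x"
    "1 - \<delta> \<le> prob {\<omega>\<in>space M. \<forall>i\<le>m. X i \<omega> \<in> F}"
    using walk_tight[OF \<delta>, of m] by blast
  define A where "A = {\<omega>\<in>space M. \<forall>i\<le>m. X i \<omega> \<in> F}"
  have A[measurable]: "A \<in> sets M" unfolding A_def by measurable
  have Ac: "prob (space M - A) \<le> \<delta>" using F(4)[folded A_def] prob_compl[OF A] by linarith
  let ?E = "\<lambda>t. {\<omega>\<in>space M. (\<forall>i\<le>t. X i \<omega> \<in> F - z) \<and> X (Suc t) \<omega> \<in> z}"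
  have term_le: "s ^ Suc t * prob {\<omega>\<in>space M. ?T \<omega> = enat (Suc t)} \<le> \<delta> + s ^ Suc t * prob (?E t)" if "t < m" for t
  proof -
    have "prob {\<omega>\<in>space M. ?T \<omega> = enat (Suc t)} \<le> prob ((space M - A) \<union> ?E t)"
    proof (rule finite_measure_mono)
      show "{\<omega>\<in>space M. ?T \<omega> = enat (Suc t)} \<subseteq> (space M - A) \<union> ?E t"
      proof (intro subsetI)
        fix \<omega> assume "\<omega> \<in> {\<omega>\<in>space M. ?T \<omega> = enat (Suc t)}"
        then have \<omega>: "\<omega> \<in> space M" "X (Suc t) \<omega> \<in> z" "\<forall>i<Suc t. X i \<omega> \<notin> z"
          by (auto simp: hitting_time_eq_enat)
        show "\<omega> \<in> (space M - A) \<union> ?E t"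
        proof (cases "\<omega> \<in> A")
          case True
          then have "\<forall>i\<le>t. X i \<omega> \<in> F - z" using \<omega>(3) that by (simp add: A_def less_Suc_eq_le)
          then show ?thesis using \<omega> by simp
        qed (use \<omega> in simp)
      qed
      show "(space M - A) \<union> ?E t \<in> sets M" by measurable
    qed
    also have "\<dots> \<le> prob (space M - A) + prob (?E t)"
    proof (rule measure_Un_le)
      show "space M - A \<in> sets M" "?E t \<in> sets M" by measurable
    qed
    finally have "s ^ Suc t * prob {\<omega>\<in>space M. ?T \<omega> = enat (Suc t)} \<le> s ^ Suc t * (\<delta> + prob (?E t))"
      using s Ac by (intro mult_left_mono) auto
    moreover have "s ^ Suc t * \<delta> \<le> \<delta>"
      using s \<delta> by (intro mult_left_le_one_le power_le_one) auto
    ultimately show ?thesis by (simp add: distrib_left)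
  qed
  have zero: "prob {\<omega>\<in>space M. ?T \<omega> = enat 0} = 0"
  proof -
    have "prob {\<omega>\<in>space M. ?T \<omega> = enat 0} \<le> prob (space M - {\<omega>\<in>space M. X 0 \<omega> = src})"
      using assms(1) by (intro finite_measure_mono) (auto simp: hitting_time_eq_enat)
    also have "\<dots> = 0" using start_prob by (subst prob_compl) auto
    finally show ?thesis by (simp add: measure_le_0_iff)
  qed
  have "(\<Sum>t\<le>m. s ^ t * prob {\<omega>\<in>space M. ?T \<omega> = enat t}) =
      (\<Sum>t<m. s ^ Suc t * prob {\<omega>\<in>space M. ?T \<omega> = enat (Suc t)})"
    using zero by (simp add: sum.atMost_shift)
  also have "\<dots> \<le> (\<Sum>t<m. \<delta> + s ^ Suc t * prob (?E t))"
    using term_le by (intro sum_mono) simp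
  also have "\<dots> = real m * \<delta> + (\<Sum>t<m. s ^ Suc t * prob (?E t))"
    by (simp add: sum.distrib)
  also have "real m * \<delta> \<le> \<epsilon>" using \<epsilon> by (simp add: \<delta>_def field_simps)
  also have "(\<Sum>t<m. s ^ Suc t * prob (?E t)) \<le>
      killed_walk.hit (F - z) w (vertex_weight w) (\<lambda>x. infsum (w x) z) s src"
    using F assms(1) s by (intro exit_probabilities_le_hit) auto
  also have "\<dots> \<le> B" using F assms(1) by (intro B) auto
  finally show "(\<Sum>t\<le>m. s ^ t * prob {\<omega>\<in>space M. ?T \<omega> = enat t}) \<le> B + \<epsilon>" by simp
qed

end

section \<open>The biased walk\<close>

lemma hitting_time_eq_infinity: "hitting_time x z = \<infinity> \<longleftrightarrow> (\<forall>t. x t \<notin> z)"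
proof -
  have "hitting_time x z \<le> enat t" if "x t \<in> z" for t
    unfolding hitting_time_def using that by (intro INF_lower) auto
  then show ?thesis
    by (auto simp: hitting_time_def top_enat_def) (metis enat_ord_simps(5) infinity_ileE)
qed

lemma hitting_time_shift:
  assumes "x 0 \<notin> z"
  shows "hitting_time x z = eSuc (hitting_time (\<lambda>t. x (Suc t)) z)"
proof (cases "hitting_time (\<lambda>t. x (Suc t)) z")
  case (enat t)
  then have "x (Suc t) \<in> z" "\<forall>i<t. x (Suc i) \<notin> z"
    by (simp_all add: hitting_time_eq_enat)
  then have "hitting_time x z = enat (Suc t)"
    using assms by (auto simp: hitting_time_eq_enat less_Suc_eq_0_disj)
  then show ?thesis using enat by (simp add: eSuc_enat)
next
  case infinity
  then have "x t \<notin> z" for t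
    using assms by (cases t) (auto simp: hitting_time_eq_infinity)
  then have "hitting_time x z = \<infinity>" by (simp add: hitting_time_eq_infinity)
  then show ?thesis using infinity by simp
qed

text \<open>
  All levels are considered at once, so that conditioning on the first step gives recursions in \<open>k\<close> and the strong
  Markov property is not needed.
\<close>

definition biased_reach :: "nat \<Rightarrow> bool stream \<Rightarrow> enat" where
  "biased_reach k \<omega> = hitting_time (biased_walk \<omega>) {int k}"

lemma biased_reach_1: "biased_reach 1 = biased_hit"
  by (simp add: biased_reach_def biased_hit_def fun_eq_iff)

lemma biased_reach_0: "biased_reach 0 \<omega> = 0"
  using hitting_time_eq_enat[of "biased_walk \<omega>" "{0}" 0]
  by (simp add: biased_reach_def biased_walk_def zero_enat_def)

lemma biased_reach_Suc:
  "biased_reach (Suc k) (c ## \<omega>) = eSuc (biased_reach (if c then k else Suc (Suc k)) \<omega>)"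
proof -
  have walk: "biased_walk (c ## \<omega>) (Suc t) = (if c then 1 else - 1) + biased_walk \<omega> t" for t
    unfolding biased_walk_def sum.lessThan_Suc_shift by simp
  have "biased_reach (Suc k) (c ## \<omega>) = eSuc (hitting_time (\<lambda>t. biased_walk (c ## \<omega>) (Suc t)) {int (Suc k)})"
    unfolding biased_reach_def by (intro hitting_time_shift) (simp add: biased_walk_def)
  also have "hitting_time (\<lambda>t. biased_walk (c ## \<omega>) (Suc t)) {int (Suc k)} =
      biased_reach (if c then k else Suc (Suc k)) \<omega>"
    unfolding biased_reach_def hitting_time_def walk by (rule arg_cong[where f = Inf]) auto
  finally show ?thesis .
qed

text \<open>
  The power \<open>s\<^sup>T\<close>, where \<open>s\<^sup>\<infinity> = 0\<close>.
\<close>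

definition pow_enat :: "real \<Rightarrow> enat \<Rightarrow> real" where
  "pow_enat s T = (case T of enat t \<Rightarrow> s ^ t | \<infinity> \<Rightarrow> 0)"

lemma pow_enat_eSuc: "pow_enat s (eSuc T) = s * pow_enat s T"
  by (cases T) (auto simp: pow_enat_def eSuc_enat)

lemma pow_enat_bounds: "0 \<le> s \<Longrightarrow> s \<le> 1 \<Longrightarrow> 0 \<le> pow_enat s T \<and> pow_enat s T \<le> 1"
  by (cases T) (auto simp: pow_enat_def power_le_one)

locale biased =
  fixes g :: real
  assumes g: "1 < g"
begin

definition p :: real where "p = g / (1 + g)"
definition q :: real where "q = 1 / (1 + g)"

lemma pq: "0 \<le> p" "0 \<le> q" "p + q = 1"
  using g by (auto simp: p_def q_def add_divide_distrib[symmetric])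

sublocale prob_space "biased_steps g"
  unfolding biased_steps_def by (intro prob_space.prob_space_stream_space prob_space_measure_pmf)

lemma space_biased [simp]: "space (biased_steps g) = UNIV"
  by (simp add: biased_steps_def space_stream_space)

lemma prob_UNIV [simp]: "prob UNIV = 1"
  using prob_space by simp

lemma emeasure_UNIV [simp]: "emeasure (biased_steps g) UNIV = 1"
  using emeasure_space_1 by simp

lemma walk_measurable [measurable]:
  "(\<lambda>\<omega>. biased_walk \<omega> t) \<in> measurable (biased_steps g) (count_space UNIV)"
proof -
  have [measurable]: "(\<lambda>\<omega>. \<omega> !! i) \<in> measurable (biased_steps g) (count_space UNIV)" for i
    unfolding biased_steps_def
    using measurable_snth[of i "measure_pmf (bernoulli_pmf (g / (1 + g)))"] by simp
  show ?thesis
  proof (induction t)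
    case (Suc t)
    have "(\<lambda>\<omega>. (\<lambda>i \<omega>. i + (if \<omega> !! t then 1 else - 1)) (biased_walk \<omega> t) \<omega>)
        \<in> measurable (biased_steps g) (count_space UNIV)"
      by (rule measurable_compose_countable[OF _ Suc]) measurable
    then show ?case by (simp add: biased_walk_def)
  qed (simp add: biased_walk_def)
qed

lemma reach_measurable [measurable]:
  "biased_reach k \<in> measurable (biased_steps g) (count_space UNIV)"
proof -
  have "biased_reach k = (\<lambda>\<omega>. if \<exists>t. biased_walk \<omega> t = int k then enat (LEAST t. biased_walk \<omega> t = int k) else \<infinity>)"
  proof
    fix \<omega>
    show "biased_reach k \<omega> = (if \<exists>t. biased_walk \<omega> t = int k then enat (LEAST t. biased_walk \<omega> t = int k) else \<infinity>)"
    proof (cases "\<exists>t. biased_walk \<omega> t = int k")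
      case True
      then have "biased_walk \<omega> (LEAST t. biased_walk \<omega> t = int k) = int k" by (rule LeastI_ex)
      then have "biased_reach k \<omega> = enat (LEAST t. biased_walk \<omega> t = int k)"
        unfolding biased_reach_def hitting_time_def
        by (intro antisym INF_lower INF_greatest) (auto intro: Least_le)
      then show ?thesis using True by simp
    next
      case False
      then show ?thesis by (simp add: biased_reach_def hitting_time_def top_enat_def)
    qed
  qed
  also have "\<dots> \<in> measurable (biased_steps g) (count_space UNIV)" by measurable
  finally show ?thesis .
qed

lemma nn_integral_first_step:
  assumes "f \<in> borel_measurable (biased_steps g)"
  shows "(\<integral>\<^sup>+\<omega>. f \<omega> \<partial>biased_steps g) =
    ennreal p * (\<integral>\<^sup>+\<omega>. f (True ## \<omega>) \<partial>biased_steps g) +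
    ennreal q * (\<integral>\<^sup>+\<omega>. f (False ## \<omega>) \<partial>biased_steps g)"
  using assms unfolding biased_steps_def
  by (subst prob_space.nn_integral_stream_space[OF prob_space_measure_pmf]) (use g in \<open>auto simp: p_def q_def field_simps\<close>)

definition reach_laplace :: "real \<Rightarrow> nat \<Rightarrow> real" where
  "reach_laplace s k = (\<integral>\<omega>. pow_enat s (biased_reach k \<omega>) \<partial>biased_steps g)"

lemma pow_enat_integrable:
  assumes "0 \<le> s" "s \<le> 1"
  shows "integrable (biased_steps g) (\<lambda>\<omega>. pow_enat s (biased_reach k \<omega>))"
  using pow_enat_bounds[OF assms] by (intro integrable_const_bound[where B = 1]) auto

lemma reach_laplace_bounds:
  assumes "0 \<le> s" "s \<le> 1"
  shows "0 \<le> reach_laplace s k" "reach_laplace s k \<le> 1"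
proof -
  show "0 \<le> reach_laplace s k" unfolding reach_laplace_def using pow_enat_bounds[OF assms] by (intro integral_nonneg_AE) auto
  have "reach_laplace s k \<le> (\<integral>\<omega>. 1 \<partial>biased_steps g)"
    unfolding reach_laplace_def using pow_enat_bounds[OF assms] pow_enat_integrable[OF assms] by (intro integral_mono) auto
  then show "reach_laplace s k \<le> 1" by (simp add: prob_space)
qed

lemma reach_laplace_nn:
  assumes "0 \<le> s" "s \<le> 1"
  shows "(\<integral>\<^sup>+\<omega>. ennreal (pow_enat s (biased_reach k \<omega>)) \<partial>biased_steps g) = ennreal (reach_laplace s k)"
  unfolding reach_laplace_def using pow_enat_bounds[OF assms] pow_enat_integrable[OF assms]
  by (intro nn_integral_eq_integral) auto

lemma reach_laplace_0: "reach_laplace s 0 = 1"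
  by (simp add: reach_laplace_def biased_reach_0 pow_enat_def zero_enat_def prob_space)

lemma reach_laplace_Suc:
  assumes "0 \<le> s" "s \<le> 1"
  shows "reach_laplace s (Suc k) = s * (p * reach_laplace s k + q * reach_laplace s (Suc (Suc k)))"
proof -
  have shift: "(\<integral>\<^sup>+\<omega>. ennreal (s * pow_enat s (biased_reach j \<omega>)) \<partial>biased_steps g) = ennreal (s * reach_laplace s j)" for j
    using assms pow_enat_bounds[OF assms] reach_laplace_bounds[OF assms]
    by (simp add: ennreal_mult nn_integral_cmult reach_laplace_nn)
  have "ennreal (reach_laplace s (Suc k)) = ennreal p * ennreal (s * reach_laplace s k) + ennreal q * ennreal (s * reach_laplace s (Suc (Suc k)))"
    unfolding reach_laplace_nn[OF assms, symmetric]
    by (subst nn_integral_first_step) (auto simp: biased_reach_Suc pow_enat_eSuc shift)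
  also have "\<dots> = ennreal (p * (s * reach_laplace s k) + q * (s * reach_laplace s (Suc (Suc k))))"
    using pq assms reach_laplace_bounds[OF assms] by (simp add: ennreal_mult)
  finally show ?thesis
    using pq assms reach_laplace_bounds[OF assms]
    by (subst (asm) ennreal_inj) (auto intro!: add_nonneg_nonneg mult_nonneg_nonneg simp: algebra_simps)
qed

text \<open>
  Both sides are bounded solutions of the recursion from the first step with the same value at 0. The recursion
  contracts differences of bounded solutions by the factor \<open>s\<close>.
\<close>

lemma reach_laplace_eq_power:
  assumes \<phi>: "0 < \<phi>" "\<phi> < 1"
  shows "reach_laplace (discount g \<phi>) k = \<phi> ^ k"
proof -
  define s where "s = discount g \<phi>"
  have s: "0 < s" "s < 1" using discount_bounds[OF g \<phi>] by (simp_all add: s_def)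
  have "0 < g + \<phi>\<^sup>2" using g by (simp add: add_pos_nonneg)
  then have root: "\<phi> = s * (p + q * \<phi>\<^sup>2)"
    using g by (simp add: s_def discount_def p_def q_def add_divide_distrib[symmetric])
  have close: "\<bar>reach_laplace s k - \<phi> ^ k\<bar> \<le> s ^ N" for N k
  proof (induction N arbitrary: k)
    case 0
    have "0 \<le> \<phi> ^ k" "\<phi> ^ k \<le> 1" using \<phi> by (auto intro: power_le_one)
    then show ?case using reach_laplace_bounds[of s k] s by simp
  next
    case (Suc N)
    show ?case
    proof (cases k)
      case 0
      then show ?thesis using s by (simp add: reach_laplace_0)
    next
      case (Suc j)
      have "\<phi> ^ k = s * (p * \<phi> ^ j + q * \<phi> ^ Suc (Suc j))"
      proof -
        have "\<phi> * \<phi> ^ j = s * (p + q * \<phi>\<^sup>2) * \<phi> ^ j"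
          by (rule arg_cong[OF root, of "\<lambda>x. x * \<phi> ^ j"])
        also have "\<dots> = s * (p * \<phi> ^ j + q * \<phi> ^ Suc (Suc j))"
          by (simp add: algebra_simps power2_eq_square)
        finally show ?thesis by (simp add: Suc)
      qed
      then have eq: "reach_laplace s k - \<phi> ^ k = s * (p * (reach_laplace s j - \<phi> ^ j) + q * (reach_laplace s (Suc (Suc j)) - \<phi> ^ Suc (Suc j)))"
        using reach_laplace_Suc[of s j] s unfolding Suc by (simp add: right_diff_distrib distrib_left)
      have "\<bar>p * (reach_laplace s j - \<phi> ^ j) + q * (reach_laplace s (Suc (Suc j)) - \<phi> ^ Suc (Suc j))\<bar> \<le> p * s ^ N + q * s ^ N"
        using pq Suc.IH[of j] Suc.IH[of "Suc (Suc j)"]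
        by (intro order_trans[OF abs_triangle_ineq] add_mono) (auto simp only: abs_mult abs_of_nonneg diff_ge_0_iff_ge intro!: mult_left_mono)
      also have "p * s ^ N + q * s ^ N = s ^ N"
        using pq(3) by (simp add: distrib_right[symmetric])
      finally show ?thesis
        unfolding eq abs_mult using s by (simp add: mult_left_mono)
    qed
  qed
  have "(\<lambda>N. s ^ N) \<longlonglongrightarrow> 0" using s by (intro LIMSEQ_power_zero) auto
  then have "\<bar>reach_laplace s k - \<phi> ^ k\<bar> \<le> 0"
    using close by (intro LIMSEQ_le_const[where X = "\<lambda>N. s ^ N"]) auto
  then show ?thesis by (simp add: s_def)
qed

text \<open>
  The linear function \<open>k * coth_val g\<close> solves the recursion for the means, and it dominates the means of the truncated
  times by induction on the truncation.
\<close>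

lemma mean_reach_le:
  "(\<integral>\<^sup>+\<omega>. ennreal_of_enat (biased_reach k \<omega>) \<partial>biased_steps g) \<le> ennreal (real k * coth_val g)"
proof -
  have m: "0 < coth_val g" using coth_val_gt_1[OF g] by simp
  have mean: "(p + q) + (p * (real k * coth_val g) + q * (real (Suc (Suc k)) * coth_val g)) = real (Suc k) * coth_val g" for k
    using g by (simp add: coth_val_def p_def q_def divide_simps) (simp add: algebra_simps)
  have "(\<integral>\<^sup>+\<omega>. ennreal_of_enat (min (biased_reach k \<omega>) (enat N)) \<partial>biased_steps g) \<le> ennreal (real k * coth_val g)" for N k
  proof (induction N arbitrary: k)
    case 0
    then show ?case by (simp add: zero_enat_def[symmetric])
  next
    case (Suc N)
    show ?case
    proof (cases k)
      case 0
      then show ?thesis by (simp add: biased_reach_0)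
    next
      case (Suc j)
      have comb: "ennreal p * ennreal x + ennreal q * ennreal y = ennreal (p * x + q * y)"
        if "0 \<le> x" "0 \<le> y" for x y
        using that pq by (simp add: ennreal_mult)
      have min_eSuc: "ennreal_of_enat (min (eSuc T) (enat (Suc N))) = 1 + ennreal_of_enat (min T (enat N))" for T
        by (cases T) (auto simp: eSuc_enat min_def)
      have int: "(\<integral>\<^sup>+\<omega>. 1 + ennreal_of_enat (min (biased_reach i \<omega>) (enat N)) \<partial>biased_steps g) \<le> ennreal (1 + real i * coth_val g)" for i
        using Suc.IH[of i] m by (simp add: nn_integral_add emeasure_space_1 ennreal_plus add_left_mono)
      have "(\<integral>\<^sup>+\<omega>. ennreal_of_enat (min (biased_reach k \<omega>) (enat (Suc N))) \<partial>biased_steps g) =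
          ennreal p * (\<integral>\<^sup>+\<omega>. 1 + ennreal_of_enat (min (biased_reach j \<omega>) (enat N)) \<partial>biased_steps g) +
          ennreal q * (\<integral>\<^sup>+\<omega>. 1 + ennreal_of_enat (min (biased_reach (Suc (Suc j)) \<omega>) (enat N)) \<partial>biased_steps g)"
        unfolding Suc by (subst nn_integral_first_step) (auto simp: biased_reach_Suc min_eSuc)
      also have "\<dots> \<le> ennreal p * ennreal (1 + real j * coth_val g) + ennreal q * ennreal (1 + real (Suc (Suc j)) * coth_val g)"
        by (intro add_mono mult_left_mono int) auto
      also have "\<dots> = ennreal (p * (1 + real j * coth_val g) + q * (1 + real (Suc (Suc j)) * coth_val g))"
        using m by (intro comb add_nonneg_nonneg mult_nonneg_nonneg) auto
      also have "p * (1 + real j * coth_val g) + q * (1 + real (Suc (Suc j)) * coth_val g) = real k * coth_val g"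
        using mean[of j] pq(3) unfolding Suc by (simp add: algebra_simps)
      finally show ?thesis .
    qed
  qed
  moreover have "(\<integral>\<^sup>+\<omega>. ennreal_of_enat (biased_reach k \<omega>) \<partial>biased_steps g) =
      (SUP N. \<integral>\<^sup>+\<omega>. ennreal_of_enat (min (biased_reach k \<omega>) (enat N)) \<partial>biased_steps g)"
  proof (subst nn_integral_monotone_convergence_SUP[symmetric])
    show "incseq (\<lambda>N \<omega>. ennreal_of_enat (min (biased_reach k \<omega>) (enat N)))"
      by (auto simp: incseq_def le_fun_def intro: min.coboundedI2)
    have lim: "ennreal_of_enat T = (SUP N. ennreal_of_enat (min T (enat N)))" for T
    proof (cases T)
      case (enat t)
      show ?thesis
      proof (intro antisym SUP_least)
        show "ennreal_of_enat T \<le> (SUP N. ennreal_of_enat (min T (enat N)))"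
          using enat by (intro SUP_upper2[of t]) auto
      qed simp
    next
      case infinity
      then have eq: "(\<lambda>N. ennreal_of_enat (min T (enat N))) = of_nat" by auto
      have sup: "(SUP N. ennreal_of_enat (min T (enat N))) = top"
        unfolding eq by (rule ennreal_SUP_of_nat_eq_top)
      show ?thesis unfolding sup using infinity by simp
    qed
    show "(\<integral>\<^sup>+\<omega>. ennreal_of_enat (biased_reach k \<omega>) \<partial>biased_steps g) =
        (\<integral>\<^sup>+\<omega>. (SUP N. ennreal_of_enat (min (biased_reach k \<omega>) (enat N))) \<partial>biased_steps g)"
      by (intro nn_integral_cong lim)
  qed auto
  ultimately show ?thesis by (auto intro: SUP_least)
qed

end

section \<open>The large deviation rate\<close>

lemma discount_surj:
  assumes "1 < g" "0 < s" "s < 1"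
  obtains \<phi> where "0 < \<phi>" "\<phi> < 1" "discount g \<phi> = s"
proof -
  have "g + x\<^sup>2 \<noteq> 0" for x using assms(1) zero_le_power2[of x] by linarith
  then have "continuous_on {0..1} (discount g)"
    unfolding discount_def[abs_def] by (intro continuous_intros) auto
  moreover have ends: "discount g 0 = 0" "discount g 1 = 1"
    using assms(1) by (simp_all add: discount_def add.commute)
  ultimately obtain x where x: "0 \<le> x" "x \<le> 1" "discount g x = s"
    using IVT'[of "discount g" 0 s 1] assms ends by auto
  moreover have "x \<noteq> 0" "x \<noteq> 1"
    using x assms ends by auto
  ultimately show ?thesis using that[of x] by simp
qed

context biased
begin

lemma m_hit_le: "m_hit g \<le> ennreal (coth_val g)"
  using mean_reach_le[of 1] by (simp only: m_hit_def biased_reach_1 of_nat_1 mult_1)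

lemma hit_measurable [measurable]: "biased_hit \<in> measurable (biased_steps g) (count_space UNIV)"
  using reach_measurable[of 1] by (simp only: biased_reach_1)

lemma AE_hit_finite: "AE \<omega> in biased_steps g. biased_hit \<omega> \<noteq> \<infinity>"
proof -
  have "m_hit g \<noteq> \<infinity>" using m_hit_le by (auto simp: top_unique)
  then have "AE \<omega> in biased_steps g. ennreal_of_enat (biased_hit \<omega>) \<noteq> \<infinity>"
    unfolding m_hit_def by (intro nn_integral_PInf_AE) auto
  then show ?thesis
  proof eventually_elim
    case (elim \<omega>)
    then show ?case by (cases "biased_hit \<omega>") auto
  qed
qed

definition steps :: "bool stream \<Rightarrow> real" where
  "steps \<omega> = real (the_enat (biased_hit \<omega>))"

lemma steps_measurable [measurable]: "steps \<in> borel_measurable (biased_steps g)"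
  unfolding steps_def[abs_def] by measurable

lemma log_mgf_negative:
  assumes "0 < \<phi>" "\<phi> < 1"
  shows "log_mgf g (ln (discount g \<phi>)) = ln \<phi>"
proof -
  define s where "s = discount g \<phi>"
  have s: "0 < s" "s < 1" using discount_bounds[OF g assms] by (simp_all add: s_def)
  have "(\<integral>\<omega>. exp (ln s * real (the_enat (biased_hit \<omega>))) \<partial>biased_steps g) = reach_laplace s 1"
    unfolding reach_laplace_def biased_reach_1
  proof (rule integral_cong_AE)
    show "AE \<omega> in biased_steps g. exp (ln s * real (the_enat (biased_hit \<omega>))) = pow_enat s (biased_hit \<omega>)"
      using AE_hit_finite
    proof eventually_elim
      case (elim \<omega>)
      then obtain t where "biased_hit \<omega> = enat t" by auto
      then show ?case using s by (simp add: pow_enat_def exp_of_nat2_mult[symmetric] exp_of_nat_mult mult.commute)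
    qed
  qed measurable
  then show ?thesis
    using reach_laplace_eq_power[OF assms, of 1] by (simp add: log_mgf_def s_def)
qed

lemma integrable_steps: "integrable (biased_steps g) steps"
  and m_hit_eq: "m_hit g = ennreal (\<integral>\<omega>. steps \<omega> \<partial>biased_steps g)"
proof -
  have eq: "m_hit g = (\<integral>\<^sup>+\<omega>. ennreal (steps \<omega>) \<partial>biased_steps g)"
    unfolding m_hit_def
  proof (rule nn_integral_cong_AE)
    show "AE \<omega> in biased_steps g. ennreal_of_enat (biased_hit \<omega>) = ennreal (steps \<omega>)"
      using AE_hit_finite
    proof eventually_elim
      case (elim \<omega>)
      then obtain t where "biased_hit \<omega> = enat t" by auto
      then show ?case by (simp add: steps_def ennreal_of_nat_eq_real_of_nat)
    qed
  qed
  have "m_hit g < \<infinity>" using m_hit_le by (auto simp: less_top[symmetric] top_unique)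
  then show int: "integrable (biased_steps g) steps"
    unfolding eq by (intro integrableI_nonneg) (auto simp: steps_def)
  show "m_hit g = ennreal (\<integral>\<omega>. steps \<omega> \<partial>biased_steps g)"
    unfolding eq by (intro nn_integral_eq_integral int) (auto simp: steps_def)
qed

text \<open>
  Jensen's inequality: for nonnegative parameters, the Chernoff bound below the mean is trivial.
\<close>

lemma log_mgf_ge_mean:
  assumes "l \<in> hit_exp_params g" "0 \<le> l" "0 \<le> a" "ennreal a \<le> m_hit g"
  shows "l * a \<le> log_mgf g l"
proof -
  define m where "m = (\<integral>\<omega>. steps \<omega> \<partial>biased_steps g)"
  have m: "0 \<le> m" unfolding m_def by (intro integral_nonneg_AE) (auto simp: steps_def)
  have am: "a \<le> m" using assms(3,4) m by (simp add: m_hit_eq m_def[symmetric])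
  have int: "integrable (biased_steps g) (\<lambda>\<omega>. exp (l * steps \<omega>))"
    using assms(1) by (simp add: hit_exp_params_def steps_def)
  have "exp (l * m) = (\<integral>\<omega>. exp (l * m) * (1 + l * (steps \<omega> - m)) \<partial>biased_steps g)"
    using integrable_steps by (simp add: m_def[symmetric] right_diff_distrib)
  also have "\<dots> \<le> (\<integral>\<omega>. exp (l * steps \<omega>) \<partial>biased_steps g)"
  proof (rule integral_mono[OF _ int])
    show "integrable (biased_steps g) (\<lambda>\<omega>. exp (l * m) * (1 + l * (steps \<omega> - m)))"
      using integrable_steps by simp
    show "exp (l * m) * (1 + l * (steps \<omega> - m)) \<le> exp (l * steps \<omega>)" for \<omega>
    proof -
      have "exp (l * m) * (1 + l * (steps \<omega> - m)) \<le> exp (l * m) * exp (l * (steps \<omega> - m))"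
        by (intro mult_left_mono exp_ge_add_one_self) auto
      then show ?thesis by (simp add: exp_add[symmetric] right_diff_distrib)
    qed
  qed
  finally have "ln (exp (l * m)) \<le> ln (\<integral>\<omega>. exp (l * steps \<omega>) \<partial>biased_steps g)"
    by (subst ln_le_cancel_iff) (auto intro: less_le_trans[OF exp_gt_zero])
  then have "l * m \<le> log_mgf g l" by (simp add: log_mgf_def steps_def)
  moreover have "l * a \<le> l * m" using am assms(2) by (intro mult_left_mono)
  ultimately show ?thesis by simp
qed

end

text \<open>
  The mean is the limit \<open>\<phi> \<rightarrow> 1\<close> of the secant bound, written as the continuous function \<open>h\<close> below. The tail is
  Markov's inequality for each parameter of the Legendre transform.
\<close>

lemma (in prob_space) hitting_bounds_of_laplace:
  fixes T :: "'a \<Rightarrow> enat"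
  assumes T: "T \<in> measurable M (count_space UNIV)" and g: "1 < g"
    and laplace: "\<And>\<phi> m. 0 < \<phi> \<Longrightarrow> \<phi> < 1 \<Longrightarrow>
      (\<Sum>t\<le>m. discount g \<phi> ^ t * prob {\<omega>\<in>space M. T \<omega> = enat t}) \<le> discount g \<phi> * \<phi> ^ n"
  shows "hitting_bounds M T n g"
proof -
  interpret B: biased g by unfold_locales (rule g)
  have mean: "m_hit g * of_nat n + 1 \<le> (\<integral>\<^sup>+\<omega>. ennreal_of_enat (T \<omega>) \<partial>M)"
  proof (cases "\<integral>\<^sup>+\<omega>. ennreal_of_enat (T \<omega>) \<partial>M")
    case (real E)
    define h where "h x = 1 + discount g x * (\<Sum>i<n. x ^ i) * (g + x\<^sup>2) / (g - x)" for x
    have le: "h \<phi> \<le> E" if \<phi>: "0 < \<phi>" "\<phi> < 1" for \<phi>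
    proof -
      define s where "s = discount g \<phi>"
      have s: "0 < s" "s < 1" using discount_bounds[OF g \<phi>] by (simp_all add: s_def)
      have pos: "0 < g + \<phi>\<^sup>2" using g by (simp add: add_pos_nonneg)
      then have s1: "1 - s = (1 - \<phi>) * (g - \<phi>) / (g + \<phi>\<^sup>2)"
        by (simp add: s_def discount_def field_simps power2_eq_square)
      have geo: "1 - \<phi> ^ n = (1 - \<phi>) * (\<Sum>i<n. \<phi> ^ i)"
        by (rule one_diff_power_eq)
      have "(1 - s * \<phi> ^ n) / (1 - s) = 1 + s * (1 - \<phi> ^ n) / (1 - s)"
        using s by (simp add: field_simps)
      also have "\<dots> = h \<phi>"
        unfolding geo s1 h_def using \<phi> by (simp add: s_def mult.assoc)
      finally have "ennreal (h \<phi>) \<le> ennreal E"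
        using mean_ge_of_laplace[OF T s, of "s * \<phi> ^ n"] laplace[OF \<phi>] real by (simp add: s_def)
      then show ?thesis using real by (simp add: ennreal_le_iff)
    qed
    have "isCont h 1"
      unfolding h_def discount_def using g
      by (intro continuous_intros) (auto simp: add_pos_nonneg)
    then have "(h \<longlongrightarrow> h 1) (at_left 1)"
      unfolding isCont_def by (rule filterlim_mono) (auto simp: at_le)
    moreover have "eventually (\<lambda>x. x \<in> {0<..<1}) (at_left (1::real))"
      by (intro eventually_at_left_real) simp
    then have "eventually (\<lambda>x. h x \<le> E) (at_left 1)"
      by eventually_elim (use le in auto)
    ultimately have "h 1 \<le> E" by (intro tendsto_upperbound) auto
    moreover have "h 1 = real n * coth_val g + 1"
      using g by (simp add: h_def discount_def coth_val_def add_ac)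
    ultimately have "ennreal (real n * coth_val g + 1) \<le> ennreal E" by (simp add: ennreal_leI)
    moreover have "m_hit g * of_nat n + 1 \<le> ennreal (coth_val g) * of_nat n + 1"
      by (intro add_right_mono mult_right_mono B.m_hit_le) auto
    moreover have "ennreal (coth_val g) * of_nat n + 1 = ennreal (real n * coth_val g + 1)"
      using coth_val_gt_1[OF g]
      by (simp add: ennreal_plus ennreal_mult ennreal_of_nat_eq_real_of_nat mult.commute)
    ultimately show ?thesis using real by (metis order_trans)
  qed simp
  have tail: "prob {\<omega>\<in>space M. ereal_of_enat (T \<omega>) \<le> ereal (a * real n + 1)} \<le> exp (- I_rate g a * real n)"
    if a: "1 \<le> a" "ennreal a \<le> m_hit g" for a
  proof -
    define P where "P = prob {\<omega>\<in>space M. ereal_of_enat (T \<omega>) \<le> ereal (a * real n + 1)}"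
    have P1: "P \<le> 1" by (simp add: P_def)
    have chernoff: "P \<le> exp (- (l * a - log_mgf g l) * real n)" if l: "l \<in> hit_exp_params g" for l
    proof (cases "0 \<le> l")
      case True
      then have "l * a \<le> log_mgf g l" using a l by (intro B.log_mgf_ge_mean) auto
      then have "1 \<le> exp (- (l * a - log_mgf g l) * real n)" by simp
      then show ?thesis using P1 by linarith
    next
      case False
      define s where "s = exp l"
      have s: "0 < s" "s < 1" using False by (auto simp: s_def)
      obtain \<phi> where \<phi>: "0 < \<phi>" "\<phi> < 1" "discount g \<phi> = s" using discount_surj[OF g s] .
      have lm: "log_mgf g l = ln \<phi>"
        using B.log_mgf_negative[OF \<phi>(1,2)] by (simp add: \<phi>(3) s_def)
      have "s powr (a * real n + 1) * P \<le> s * \<phi> ^ n"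
        unfolding P_def using a laplace[OF \<phi>(1,2)] \<phi>(3)
        by (intro tail_le_of_laplace T s) auto
      then have "s powr (a * real n) * P \<le> \<phi> ^ n"
        using s by (simp add: powr_add mult_ac)
      moreover have "s powr (a * real n) = exp (l * a * real n)"
        by (simp add: powr_def s_def mult_ac)
      ultimately have "P \<le> \<phi> ^ n / exp (l * a * real n)"
        by (simp add: field_simps)
      also have "\<phi> ^ n = exp (ln \<phi> * real n)"
        using \<phi> by (simp add: powr_realpow[symmetric] powr_def mult.commute)
      also have "\<dots> / exp (l * a * real n) = exp (- (l * a - log_mgf g l) * real n)"
        by (simp add: exp_diff[symmetric] lm algebra_simps)
      finally show ?thesis .
    qed
    show ?thesis
    proof (cases "n = 0 \<or> P = 0")
      case True
      then show ?thesis using P1 by (auto simp: P_def[symmetric])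
    next
      case False
      then have n: "0 < real n" and P: "0 < P" by (auto simp: P_def zero_less_measure_iff)
      have "I_rate g a \<le> - ln P / real n"
        unfolding I_rate_def
      proof (rule cSUP_least)
        have "0 \<in> hit_exp_params g" by (simp add: hit_exp_params_def)
        then show "hit_exp_params g \<noteq> {}" by blast
        fix l assume "l \<in> hit_exp_params g"
        from chernoff[OF this] have "ln P \<le> - (l * a - log_mgf g l) * real n"
          using P by (subst ln_le_cancel_iff[symmetric, of P "exp _", unfolded ln_exp, symmetric]) auto
        then show "l * a - log_mgf g l \<le> - ln P / real n"
          using n by (simp add: field_simps)
      qed
      then have "ln P \<le> - I_rate g a * real n"
        using n by (simp add: field_simps)
      then have "exp (ln P) \<le> exp (- I_rate g a * real n)" by (simp only: exp_le_cancel_iff)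
      then show ?thesis unfolding P_def[symmetric] exp_ln[OF P] .
    qed
  qed
  show ?thesis unfolding hitting_bounds_def using mean tail by blast
qed

section \<open>The explicit bound on the growth parameter\<close>

text \<open>
  The left-hand side of the equation increases with \<open>g\<close>, so it suffices that it exceeds \<open>2 * K\<close> at the proposed bound
  \<open>h\<close>. There \<open>h - 1 \<ge> ln h = ln B / N\<close>, and \<open>ln B\<close> is at least a fixed fraction of \<open>ln \<alpha>\<close>; the constant 5 suffices since
  \<open>5 * (7 / 11)\<^sup>2 > 2\<close>.
\<close>

lemma growth_le_root:
  fixes g \<alpha> K :: real
  assumes n: "3 \<le> n" and g: "1 < g" and eq: "(g - 1)\<^sup>2 * g powi (int n - 2) = 2 * K"
    and \<alpha>: "(real n)\<^sup>2 * K \<le> \<alpha>" "exp 1 \<le> \<alpha>"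
  shows "g \<le> (5 * \<alpha> / (ln \<alpha>)\<^sup>2) powr (1 / (real n - 2))"
proof (rule ccontr)
  define N where "N = n - 2"
  have N: "0 < N" "int n - 2 = int N" "real n - 2 = real N" using n by (auto simp: N_def)
  define x where "x = ln \<alpha>"
  have \<alpha>0: "0 < \<alpha>" using \<alpha>(2) exp_gt_zero[of 1] by linarith
  have x: "1 \<le> x" using \<alpha>(2) \<alpha>0 by (simp add: x_def ln_ge_iff)
  define B where "B = 5 * \<alpha> / x\<^sup>2"
  have B0: "0 < B" using \<alpha>0 x by (simp add: B_def)
  define h where "h = B powr (1 / real N)"
  assume "\<not> g \<le> (5 * \<alpha> / (ln \<alpha>)\<^sup>2) powr (1 / (real n - 2))"
  then have hg: "h < g" by (simp add: h_def B_def x_def N(3))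
  have h0: "0 < h" using B0 by (simp add: h_def)
  have hN: "h ^ N = B" using B0 N by (simp add: h_def powr_powr powr_realpow[symmetric])
  have lnB: "7 / 11 * x \<le> ln B"
  proof -
    \<comment> \<open>The tangent of \<open>2 * ln x\<close> at \<open>11 / 2\<close> has the slope \<open>4 / 11\<close>, which leaves \<open>7 / 11 * x\<close>.\<close>
    have ln_le: "2 * ln x \<le> 2 * x / c - 2 + ln (c\<^sup>2)" if "0 < c" for c :: real
    proof -
      have "ln (x / c) \<le> x / c - 1" using x that by (intro ln_le_minus_one) simp
      then have "2 * (ln x - ln c) \<le> 2 * (x / c - 1)" using x that by (simp add: ln_div)
      then show ?thesis using that by (simp add: ln_realpow)
    qed
    have "2 * ln x \<le> 4 / 11 * x - 2 + ln ((11 / 2)\<^sup>2)"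
      using ln_le[of "11 / 2"] by simp
    moreover have "ln ((11 / 2)\<^sup>2) \<le> ln (5 * exp (2::real))"
    proof -
      have "(1 + 2 / real 10) ^ 10 \<le> exp (2::real)"
        by (rule exp_ge_one_plus_x_over_n_power_n) auto
      then have "(11 / 2)\<^sup>2 \<le> 5 * exp (2::real)" by (simp add: power_divide)
      then show ?thesis by simp
    qed
    moreover have "ln (5 * exp (2::real)) = ln 5 + 2" by (simp add: ln_mult)
    moreover have "ln B = ln 5 + x - 2 * ln x"
      using \<alpha>0 x by (simp add: B_def ln_div ln_mult ln_realpow flip: x_def)
    ultimately show ?thesis by simp
  qed
  then have "0 < ln B" using x by linarith
  have "ln h = ln B / real N" using B0 by (simp add: h_def ln_powr)
  then have hl: "7 / 11 * x / real N \<le> h - 1"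
    using lnB ln_le_minus_one[OF h0] N divide_right_mono[OF lnB, of "real N"] by simp
  have "0 \<le> 7 / 11 * x / real N" using x by simp
  then have h1: "0 \<le> h - 1" using hl by linarith
  have "2 * \<alpha> / (real N)\<^sup>2 \<le> (7 / 11 * x / real N)\<^sup>2 * B"
    using x N by (simp add: B_def power_divide power_mult_distrib field_simps) (use \<alpha>0 in \<open>simp add: power2_eq_square\<close>)
  also have "\<dots> \<le> (h - 1)\<^sup>2 * h ^ N"
    unfolding hN using hl \<open>0 \<le> 7 / 11 * x / real N\<close> B0 by (intro mult_right_mono power_mono) auto
  also have "\<dots> < (g - 1)\<^sup>2 * g ^ N"
    using h1 h0 hg N by (intro mult_less_le_imp_less power_strict_mono power_mono) auto
  also have "\<dots> = 2 * K" using eq by (simp add: N(2))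
  also have "\<dots> \<le> 2 * \<alpha> / (real n)\<^sup>2"
    using \<alpha>(1) n by (simp add: field_simps)
  also have "\<dots> \<le> 2 * \<alpha> / (real N)\<^sup>2"
    using \<alpha>0 N by (intro divide_left_mono power_mono) (auto simp: N_def)
  finally show False by simp
qed

section \<open>Hitting times on weighted graphs\<close>

theorem fact2:
  fixes w :: "'a \<Rightarrow> 'a \<Rightarrow> real" and x\<^sub>0 :: 'a and z :: "'a set" and n :: nat
    and M :: "'b measure" and X :: "nat \<Rightarrow> 'b \<Rightarrow> 'a"
  assumes "weighted_graph w"
    and "vertex_weight w x\<^sub>0 > 0"
    and "(\<lambda>x. vertex_weight w x) summable_on z"
    and "graph_dist w x\<^sub>0 z \<ge> enat (n + 1)"
    and "random_walk w x\<^sub>0 M X"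
  shows "(\<forall>g g'. (growth_a w x\<^sub>0 z n g \<or> growth_b w x\<^sub>0 z n g) \<and> g \<le> g' \<longrightarrow>
             hitting_bounds M (\<lambda>\<omega>. hitting_time (\<lambda>t. X t \<omega>) z) n g') \<and>
         (3 \<le> n \<longrightarrow>
           (let \<alpha> = max ((real n)\<^sup>2 * set_weight w z / vertex_weight w x\<^sub>0) (exp 1)
            in \<forall>g. growth_a w x\<^sub>0 z n g \<longrightarrow>
                 g \<le> (5 * \<alpha> / (ln \<alpha>)\<^sup>2) powr (1 / (real n - 2))))"
proof (intro conjI allI impI)
  interpret graph_walk w x\<^sub>0 M X
    using assms by unfold_locales
  have far: "\<not> (x\<^sub>0, y) \<in> edges w ^^ k" if "y \<in> z" "k \<le> n" for y k
    using graph_dist_path[OF wg _ that(1), of x\<^sub>0 k] assms(4) that(2)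
    by (metis Suc_eq_plus1 enat_ord_simps(1) not_less_eq_eq order_trans)
  have x0: "x\<^sub>0 \<notin> z" using far[of x\<^sub>0 0] by auto
  define W where "W = set_weight w z"
  fix g g' :: real
  assume hyp: "(growth_a w x\<^sub>0 z n g \<or> growth_b w x\<^sub>0 z n g) \<and> g \<le> g'"
  have main: "hitting_bounds M (\<lambda>\<omega>. hitting_time (\<lambda>t. X t \<omega>) z) n g'"
    if g': "1 < g'" and hit: "\<And>F \<phi>. finite F \<Longrightarrow> F \<inter> z = {} \<Longrightarrow> x\<^sub>0 \<in> F \<Longrightarrow> (\<And>x. x \<in> F \<Longrightarrow> 0 < vertex_weight w x) \<Longrightarrow>
      0 < \<phi> \<Longrightarrow> \<phi> < 1 \<Longrightarrow>
      killed_walk.hit F w (vertex_weight w) (\<lambda>x. infsum (w x) z) (discount g' \<phi>) x\<^sub>0 \<le> discount g' \<phi> * \<phi> ^ n"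
    using hit discount_bounds[OF g'] by (intro hitting_bounds_of_laplace g' laplace_le x0) auto
  consider "n = 0" "growth_a w x\<^sub>0 z n g" | "0 < n" "growth_a w x\<^sub>0 z n g" | "growth_b w x\<^sub>0 z n g"
    using hyp by blast
  then show "hitting_bounds M (\<lambda>\<omega>. hitting_time (\<lambda>t. X t \<omega>) z) n g'"
  proof cases
    case 1
    then have g': "1 < g'" using hyp by (simp add: growth_a_def)
    show ?thesis
    proof (rule main[OF g'])
      fix F \<phi> assume F: "finite F" "F \<inter> z = {}" "x\<^sub>0 \<in> F" "\<And>x. x \<in> F \<Longrightarrow> 0 < vertex_weight w x"
        and \<phi>: "0 < \<phi>" "\<phi> < (1::real)"
      interpret killed_walk F x\<^sub>0 w "vertex_weight w" "\<lambda>x. infsum (w x) z"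
        using killed_walk_subset[OF wg F] .
      show "hit (discount g' \<phi>) x\<^sub>0 \<le> discount g' \<phi> * \<phi> ^ n"
        using hit_le[OF F(3), of "discount g' \<phi>"] discount_bounds[OF g' \<phi>] 1(1) by simp
    qed
  next
    case 2
    then have g: "1 < g" and eq: "(g - 1)\<^sup>2 * g powi (int n - 2) = 2 * W / vertex_weight w x\<^sub>0"
      by (simp_all add: growth_a_def W_def)
    have g': "1 < g'" using g hyp by simp
    have "0 < (g - 1)\<^sup>2 * g powi (int n - 2)" using g by (intro mult_pos_pos) auto
    then have W: "0 < W" using eq src_weight by (simp add: zero_less_divide_iff)
    have "2 * W / vertex_weight w x\<^sub>0 = (1 - 1 / g)\<^sup>2 * g ^ n"
    proof -
      have "g powi (int n - 2) = g ^ n / g\<^sup>2" using g by (simp add: power_int_diff)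
      moreover have "1 - 1 / g = (g - 1) / g" using g by (simp add: diff_divide_distrib)
      ultimately show ?thesis using eq by (simp add: power_divide)
    qed
    also have "\<dots> \<le> (1 - 1 / g')\<^sup>2 * g' ^ n"
      using g hyp by (intro mult_mono power_mono diff_mono divide_left_mono) auto
    finally have bound: "2 * W / vertex_weight w x\<^sub>0 \<le> (1 - 1 / g')\<^sup>2 * g' ^ n" .
    show ?thesis
    proof (rule main[OF g'])
      fix F \<phi> assume F: "finite F" "F \<inter> z = {}" "x\<^sub>0 \<in> F" "\<And>x. x \<in> F \<Longrightarrow> 0 < vertex_weight w x"
        and \<phi>: "0 < \<phi>" "\<phi> < (1::real)"
      interpret killed_walk F x\<^sub>0 w "vertex_weight w" "\<lambda>x. infsum (w x) z"
        using killed_walk_subset[OF wg F] .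
      have "infsum (w x\<^sub>0) z = 0"
        using level_exit[OF wg assms(4), of x\<^sub>0] level_src[OF wg, of x\<^sub>0 n] 2(1) b_nonneg[of x\<^sub>0] by force
      then show "hit (discount g' \<phi>) x\<^sub>0 \<le> discount g' \<phi> * \<phi> ^ n"
        using exits_le_set_weight[OF wg F(1) assms(3)] W
          level_src[OF wg] level_edge[OF wg] level_exit[OF wg assms(4)] level_neighbour[OF wg 2(1)]
        by (intro hit_le_weight[where d = "level w x\<^sub>0 n" and W = W] g' \<phi> bound) (auto simp: W_def)
    qed
  next
    case 3
    define r where "r = enn2real (eff_resistance w x\<^sub>0 z)"
    have n: "0 < n" and fin: "eff_resistance w x\<^sub>0 z < \<infinity>" and g: "g = (W * r) powr (1 / real n)"
      using 3 by (simp_all add: growth_b_def W_def r_def)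
    have "w x\<^sub>0 y = 0" if "y \<in> z" for y
      using far[OF that, of 1] n by (auto simp: edges_def)
    then have Wr: "1 < W * r"
      unfolding W_def r_def using weight_resistance_gt_1[OF wg src_weight x0 _ assms(3) fin] by simp
    have "0 \<le> r" by (simp add: r_def)
    then have W: "0 < W" using Wr by (smt (verit) mult_nonpos_nonneg)
    have "1 < g" unfolding g using Wr n by (intro gr_one_powr) auto
    then have g': "1 < g'" using hyp by simp
    have "g ^ n = g powr real n"
      using \<open>1 < g\<close> by (intro powr_realpow[symmetric]) simp
    also have "\<dots> = W * r"
      unfolding g powr_powr using Wr n by simp
    finally have "W * r = g ^ n" ..
    also have "\<dots> \<le> g' ^ n" using \<open>1 < g\<close> hyp by (intro power_mono) auto
    finally have bound: "W * r \<le> g' ^ n" .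
    show ?thesis
    proof (rule main[OF g'])
      fix F \<phi> assume F: "finite F" "F \<inter> z = {}" "x\<^sub>0 \<in> F" "\<And>x. x \<in> F \<Longrightarrow> 0 < vertex_weight w x"
        and \<phi>: "0 < \<phi>" "\<phi> < (1::real)"
      interpret killed_walk F x\<^sub>0 w "vertex_weight w" "\<lambda>x. infsum (w x) z"
        using killed_walk_subset[OF wg F] .
      have "W * green s x\<^sub>0 \<le> g' ^ n" if "0 < s" "s < 1" for s
      proof -
        have "ennreal (green s x\<^sub>0) \<le> ennreal r"
          using green_le_resistance[OF wg F that] fin by (simp add: r_def ennreal_enn2real)
        then have "green s x\<^sub>0 \<le> r" using \<open>0 \<le> r\<close> by (simp add: ennreal_le_iff)
        then have "W * green s x\<^sub>0 \<le> W * r" using W by simp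
        then show ?thesis using bound by linarith
      qed
      then show "hit (discount g' \<phi>) x\<^sub>0 \<le> discount g' \<phi> * \<phi> ^ n"
        using exits_le_set_weight[OF wg F(1) assms(3)] W
          level_src[OF wg] level_edge[OF wg] level_exit[OF wg assms(4)]
        by (intro hit_le_resistance[where d = "level w x\<^sub>0 n" and W = W] g' \<phi>) (auto simp: W_def)
    qed
  qed
next
  assume n: "3 \<le> n"
  show "let \<alpha> = max ((real n)\<^sup>2 * set_weight w z / vertex_weight w x\<^sub>0) (exp 1)
      in \<forall>g. growth_a w x\<^sub>0 z n g \<longrightarrow> g \<le> (5 * \<alpha> / (ln \<alpha>)\<^sup>2) powr (1 / (real n - 2))"
    unfolding Let_def growth_a_def
    using growth_le_root[OF n, where K = "set_weight w z / vertex_weight w x\<^sub>0"] by auto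
qed

end
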